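(* Let $E$ be a metric space, let $\gamma:E\to(0,+\infty)$ be continuous, and let $\boldsymbol{\mu}=\{\mu_t(\xi,\cdot)\}_{t\in\mathbb{R}^+,\,\xi\in E}\subset\mathbf{ca}^+(E)$. Let $\boldsymbol{\mu}^\gamma=\{\mu^\gamma_t(\xi,\cdot)\}_{t\in\mathbb{R}^+,\,\xi\in E}$ be defined by $$\mu^\gamma_t(\xi,\Gamma)=\gamma(\xi)\int_\Gamma\gamma^{-1}(\xi')\,\mu_t(\xi,d\xi')\qquad\forall\,\Gamma\in\mathcal{E},\ \forall\,\xi\in E,$$ and assume that $\boldsymbol{\mu}^\gamma$ is a family in $\mathbf{ca}^+(E)$ satisfying conditions (A1)–(A5) of the context. Then $T=\{T_t\}_{t\in\mathbb{R}^+}$ defined by $$T_tf(\xi)=\int_Ef(\xi')\,\mu_t(\xi,d\xi'),\qquad f\in C_\gamma(E),\ \xi\in E,\ t\in\mathbb{R}^+,$$ is a $C_0$-sequentially locally equicontinuous semigroup on $(C_\gamma(E),\tau^\gamma_{\mathcal{K}})$. Moreover, for every $\alpha>0$, the normalized semigroup $\{e^{-\alpha t}T_t\}_{t\in\mathbb{R}^+}$ is a $C_0$-sequentially equicontinuous semigroup on $(C_\gamma(E),\tau^\gamma_{\mathcal{K}})$ such that, for every $f\in C_\gamma(E)$ and $\lambda>0$, the generalized Riemann integral $\int_0^{+\infty}e^{-\lambda t}e^{-\alpha t}T_tf\,dt$ exists in $(C_\gamma(E),\tau^\gamma_{\mathcal{K}})$.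
   Context: $\mathbb{R}^+=[0,+\infty)$; $C(E)$ and $C_b(E)$ are the spaces of continuous, respectively bounded continuous, real-valued functions on $E$; $\mathbf{ca}(E)$ (resp. $\mathbf{ca}^+(E)$) is the set of countably additive finite signed (resp. positive) measures on the Borel $\sigma$-algebra $\mathcal{E}$ of $E$, with total variation norm. $\gamma^{-1}=1/\gamma$. $C_\gamma(E)=\{f\in C(E):f\gamma\in C_b(E)\}$, and $\tau^\gamma_{\mathcal{K}}$ is the locally convex topology on $C_\gamma(E)$ generated by the seminorms $p^\gamma_{K,\mu}(f)=\sup_{x\in K}|f(x)\gamma(x)|+\left|\int_Ef\gamma\,d\mu\right|$, with $K$ ranging over the non-empty compact subsets of $E$ and $\mu$ over $\mathbf{ca}(E)$. Conditions (A1)–(A5) for a family $\boldsymbol{\nu}=\{\nu_t(\xi,\cdot)\}_{t\in\mathbb{R}^+,\xi\in E}\subset\mathbf{ca}^+(E)$: (A1) $\boldsymbol{\nu}$ is bounded in $\mathbf{ca}^+(E)$ and $\nu_0(\xi,\Gamma)=\mathbf{1}_\Gamma(\xi)$ for every $\xi\in E$, $\Gamma\in\mathcal{E}$; (A2) for every $f\in C_b(E)$ and $t\in\mathbb{R}^+$, the map $\xi\mapsto\int_Ef(\xi')\nu_t(\xi,d\xi')$ is continuous on $E$; (A3) for every $f\in C_b(E)$, $t,s\in\mathbb{R}^+$, $\xi\in E$: $\int_Ef(\xi')\nu_{t+s}(\xi,d\xi')=\int_E\left(\int_Ef(\xi'')\nu_t(\xi',d\xi'')\right)\nu_s(\xi,d\xi')$;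 (A4) for every $\hat t>0$ and every compact $K\subset E$, the family $\{\nu_t(\xi,\cdot):t\in[0,\hat t],\xi\in K\}$ is tight, i.e. for every $\epsilon>0$ there is a compact $K_0\subset E$ with $\nu_t(\xi,K_0)>\nu_t(\xi,E)-\epsilon$ for all $t\in[0,\hat t]$, $\xi\in K$; (A5) for every $r>0$ and every non-empty compact $K\subset E$, $\lim_{t\to0^+}\sup_{\xi\in K}|\nu_t(\xi,B(\xi,r))-1|=0$, where $B(\xi,r)$ is the open ball. A family $\{f_\iota\}_{\iota\in\mathcal{I}}$ of maps from a topological vector space $Z$ to itself is sequentially equicontinuous if for every $z_n\to z$ in $Z$ and every neighborhood $U$ of $0$ there is $\overline n$ with $f_\iota(z_n)\in f_\iota(z)+U$ for all $\iota\in\mathcal{I}$, $n\ge\overline n$. A family of linear operators $\{T_t\}_{t\in\mathbb{R}^+}$ on a Hausdorff locally convex space $Z$ is a $C_0$-sequentially equicontinuous (resp. $C_0$-sequentially locally equicontinuous) semigroup if $T_0=I$, $T_{t+s}=T_tT_s$, $\lim_{t\to0^+}T_tz=z$ for all $z\in Z$, and $\{T_t\}_{t\in\mathbb{R}^+}$ is sequentially equicontinuous (resp. $\{T_t\}_{t\in[0,R]}$ is sequentially equicontinuous for every $R>0$). The generalized Riemann integral over $[0,+\infty)$ exists if the Riemann integrals over $[0,a]$ exist for all $a\ge0$ and converge as $a\to+\infty$. *)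

theory Defs
  imports "HOL-Analysis.Analysis" "HOL-Library.Function_Algebras"
begin

section \<open>Functions as a real vector space\<close>

instantiation "fun" :: (type, real_vector) real_vector
begin

definition scaleR_fun :: "real \<Rightarrow> ('a \<Rightarrow> 'b) \<Rightarrow> 'a \<Rightarrow> 'b" where
  "scaleR_fun c f = (\<lambda>x. c *\<^sub>R f x)"

instance
  by standard (auto simp: scaleR_fun_def plus_fun_def fun_eq_iff scaleR_add_right scaleR_add_left)

end

section \<open>Topological vector spaces on a subspace of a real vector space\<close>

text \<open>The underlying vector space is \<^term>\<open>topspace T\<close>, a subspace of the ambient type.\<close>

definition hausdorff_lcs :: "'z::real_vector topology \<Rightarrow> bool" where
  "hausdorff_lcs T \<longleftrightarrow>
     subspace (topspace T) \<and>
     continuous_map (prod_topology T T) T (\<lambda>(x, y). x + y) \<and>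
     continuous_map (prod_topology euclideanreal T) T (\<lambda>(c, x). c *\<^sub>R x) \<and>
     neighbourhood_base_of convex T \<and>
     Hausdorff_space T"

definition seminorm_topology :: "'z::real_vector set \<Rightarrow> ('z \<Rightarrow> real) set \<Rightarrow> 'z topology" where
  "seminorm_topology Z P =
     topology_generated_by {{g \<in> Z. p (g - f) < e} | p f e. p \<in> P \<and> f \<in> Z \<and> 0 < e}"

definition nbhd_in :: "'z topology \<Rightarrow> 'z \<Rightarrow> 'z set \<Rightarrow> bool" where
  "nbhd_in T z U \<longleftrightarrow> U \<subseteq> topspace T \<and> (\<exists>V. openin T V \<and> z \<in> V \<and> V \<subseteq> U)"

definition seq_equicontinuous ::
  "'z::real_vector topology \<Rightarrow> 'i set \<Rightarrow> ('i \<Rightarrow> 'z \<Rightarrow> 'z) \<Rightarrow> bool" where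
  "seq_equicontinuous T I F \<longleftrightarrow>
     (\<forall>i\<in>I. F i \<in> topspace T \<rightarrow> topspace T) \<and>
     (\<forall>zs z. (\<forall>n. zs n \<in> topspace T) \<and> limitin T zs z sequentially \<longrightarrow>
       (\<forall>U. nbhd_in T 0 U \<longrightarrow>
         (\<exists>N. \<forall>i\<in>I. \<forall>n\<ge>N. F i (zs n) \<in> (\<lambda>u. F i z + u) ` U)))"

definition linear_operator_on :: "'z::real_vector set \<Rightarrow> ('z \<Rightarrow> 'z) \<Rightarrow> bool" where
  "linear_operator_on Z L \<longleftrightarrow> L \<in> Z \<rightarrow> Z \<and>
     (\<forall>x\<in>Z. \<forall>y\<in>Z. L (x + y) = L x + L y) \<and> (\<forall>c. \<forall>x\<in>Z. L (c *\<^sub>R x) = c *\<^sub>R L x)"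

text \<open>Only the values of a family at times \<open>t \<ge> 0\<close> and at points of \<^term>\<open>topspace T\<close> are constrained.\<close>

definition C0_semigroup :: "'z::real_vector topology \<Rightarrow> (real \<Rightarrow> 'z \<Rightarrow> 'z) \<Rightarrow> bool" where
  "C0_semigroup T S \<longleftrightarrow>
     hausdorff_lcs T \<and>
     (\<forall>t\<ge>0. linear_operator_on (topspace T) (S t)) \<and>
     (\<forall>z\<in>topspace T. S 0 z = z) \<and>
     (\<forall>t\<ge>0. \<forall>s\<ge>0. \<forall>z\<in>topspace T. S (t + s) z = S t (S s z)) \<and>
     (\<forall>z\<in>topspace T. limitin T (\<lambda>t. S t z) z (at_right 0))"

definition C0_seq_equicontinuous_semigroup ::
  "'z::real_vector topology \<Rightarrow> (real \<Rightarrow> 'z \<Rightarrow> 'z) \<Rightarrow> bool" where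
  "C0_seq_equicontinuous_semigroup T S \<longleftrightarrow>
     C0_semigroup T S \<and> seq_equicontinuous T {0..} S"

definition C0_seq_locally_equicontinuous_semigroup ::
  "'z::real_vector topology \<Rightarrow> (real \<Rightarrow> 'z \<Rightarrow> 'z) \<Rightarrow> bool" where
  "C0_seq_locally_equicontinuous_semigroup T S \<longleftrightarrow>
     C0_semigroup T S \<and> (\<forall>R>0. seq_equicontinuous T {0..R} S)"

text \<open>Limit of Riemann sums over tagged partitions of \<open>[a, b]\<close> as the mesh tends to \<open>0\<close>;
  \<^term>\<open>measure lborel k\<close> is the length of the interval \<open>k\<close>.\<close>

definition has_riemann_integral ::
  "'z::real_vector topology \<Rightarrow> (real \<Rightarrow> 'z) \<Rightarrow> 'z \<Rightarrow> real \<Rightarrow> real \<Rightarrow> bool" where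
  "has_riemann_integral T F J a b \<longleftrightarrow>
     J \<in> topspace T \<and>
     (\<forall>U. nbhd_in T J U \<longrightarrow>
       (\<exists>d>0. \<forall>D. D tagged_division_of {a..b} \<and> (\<forall>(x, k)\<in>D. measure lborel k < d) \<longrightarrow>
         (\<Sum>(x, k)\<in>D. measure lborel k *\<^sub>R F x) \<in> U))"

definition generalized_riemann_integrable ::
  "'z::real_vector topology \<Rightarrow> (real \<Rightarrow> 'z) \<Rightarrow> bool" where
  "generalized_riemann_integrable T F \<longleftrightarrow>
     (\<exists>G J. (\<forall>a\<ge>0. has_riemann_integral T F (G a) 0 a) \<and> limitin T G J at_top)"

section \<open>Finite signed and positive Borel measures\<close>

text \<open>A signed measure is a set function, of which only the values on Borel sets matter.\<close>

definition ca :: "('a::topological_space set \<Rightarrow> real) set" where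
  "ca = {m. m {} = 0 \<and>
     (\<forall>A::nat \<Rightarrow> 'a set. range A \<subseteq> sets borel \<and> disjoint_family A \<longrightarrow>
        (\<lambda>i. m (A i)) sums m (\<Union>i. A i))}"

definition tv_norm :: "('a::topological_space set \<Rightarrow> real) \<Rightarrow> ennreal" where
  "tv_norm m = (SUP P\<in>{P. finite P \<and> disjoint P \<and> P \<subseteq> sets borel \<and> \<Union>P = UNIV}.
     \<Sum>A\<in>P. ennreal \<bar>m A\<bar>)"

text \<open>Positive part in the Jordan decomposition: \<open>m\<^sup>+(A) = sup {m(B) | B \<subseteq> A Borel}\<close>.
  \<^const>\<open>ennreal\<close> truncates negative values to \<open>0\<close>, which is harmless since \<open>B = {}\<close> is admitted.
  The negative part of \<open>m\<close> is the positive part of \<open>-m\<close>.\<close>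

definition positive_part :: "('a::topological_space set \<Rightarrow> real) \<Rightarrow> 'a measure" where
  "positive_part m =
     measure_of UNIV (sets borel) (\<lambda>A. SUP B\<in>{B \<in> sets borel. B \<subseteq> A}. ennreal (m B))"

definition signed_integral ::
  "('a::topological_space set \<Rightarrow> real) \<Rightarrow> ('a \<Rightarrow> real) \<Rightarrow> real" where
  "signed_integral m f =
     integral\<^sup>L (positive_part m) f - integral\<^sup>L (positive_part (\<lambda>A. - m A)) f"

definition ca_plus :: "'a::topological_space measure set" where
  "ca_plus = {M. sets M = sets borel \<and> finite_measure M}"

text \<open>For \<open>m \<in> ca\<close> the supremum is countably additive, so \<^const>\<open>positive_part\<close> is the intended measure.\<close>

lemma ca_sums:
  assumes "m \<in> ca" "\<And>i::nat. A i \<in> sets borel" "disjoint_family A"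
  shows "(\<lambda>i. m (A i)) sums m (\<Union>i. A i)"
  using assms by (auto simp: ca_def)

lemma ca_Un:
  fixes m :: "'a::topological_space set \<Rightarrow> real"
  assumes m: "m \<in> ca" and X: "X \<in> sets borel" "Y \<in> sets borel" "X \<inter> Y = {}"
  shows "m (X \<union> Y) = m X + m Y"
proof -
  have "(\<lambda>i. m (binaryset X Y i)) sums m (\<Union>i. binaryset X Y i)"
    using X by (intro ca_sums m) (auto simp: binaryset_def disjoint_family_on_def)
  moreover have "(\<lambda>i. m (binaryset X Y i)) sums (m X + m Y)"
    by (rule binaryset_sums) (use m in \<open>simp add: ca_def\<close>)
  ultimately show ?thesis by (simp add: UN_binaryset_eq sums_unique2)
qed

lemma emeasure_positive_part:
  fixes m :: "'a::topological_space set \<Rightarrow> real"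
  assumes m: "m \<in> ca" and A: "A \<in> sets borel"
  shows "emeasure (positive_part m) A = (SUP B\<in>{B \<in> sets borel. B \<subseteq> A}. ennreal (m B))"
proof -
  define u where "u A = (SUP B\<in>{B \<in> sets borel. B \<subseteq> A}. ennreal (m B))" for A :: "'a set"
  have m0: "m {} = 0" using m by (simp add: ca_def)
  have up: "ennreal (m B) \<le> u A" if "B \<in> sets borel" "B \<subseteq> A" for A B
    using that unfolding u_def by (auto intro: SUP_upper)
  have pair: "ennreal (m B) + ennreal (m C) \<le> u (X \<union> Y)"
    if "X \<inter> Y = {}" "B \<in> sets borel" "B \<subseteq> X" "C \<in> sets borel" "C \<subseteq> Y" for X Y B C
  proof (cases "m B \<le> 0 \<or> m C \<le> 0")
    case True
    then show ?thesis
      using up[of B "X \<union> Y", OF that(2) le_supI1[OF that(3)]]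
        up[of C "X \<union> Y", OF that(4) le_supI2[OF that(5)]]
      by (auto simp: ennreal_neg)
  next
    case False
    have "B \<inter> C = {}" using that by blast
    then have "m (B \<union> C) = m B + m C" using that by (intro ca_Un m) auto
    then have "ennreal (m B) + ennreal (m C) = ennreal (m (B \<union> C))" using False by simp
    also have "\<dots> \<le> u (X \<union> Y)" using that by (intro up) auto
    finally show ?thesis .
  qed
  have super: "u X + u Y \<le> u (X \<union> Y)" if XY: "X \<inter> Y = {}" for X Y
  proof -
    have ne: "{B \<in> sets borel. B \<subseteq> Z} \<noteq> {}" for Z :: "'a set" by auto
    have "ennreal (m B) + u Y \<le> u (X \<union> Y)" if "B \<in> sets borel" "B \<subseteq> X" for B
    proof -
      have "ennreal (m B) + u Y = (SUP C\<in>{C \<in> sets borel. C \<subseteq> Y}. ennreal (m B) + ennreal (m C))"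
        unfolding u_def by (subst ennreal_SUP_add_right[OF ne]) simp_all
      also have "\<dots> \<le> u (X \<union> Y)" using pair[OF XY that] by (auto intro: SUP_least)
      finally show ?thesis .
    qed
    then have "(SUP B\<in>{B \<in> sets borel. B \<subseteq> X}. ennreal (m B) + u Y) \<le> u (X \<union> Y)"
      by (auto intro: SUP_least)
    then show ?thesis
      unfolding u_def[of X] by (subst ennreal_SUP_add_left[OF ne, symmetric]) simp_all
  qed
  have mono: "u X \<le> u Y" if "X \<subseteq> Y" for X Y
    unfolding u_def by (rule SUP_subset_mono) (use that in auto)
  have "countably_additive (sets borel) u"
  proof (rule countably_additiveI)
    fix F :: "nat \<Rightarrow> 'a set"
    assume F: "range F \<subseteq> sets borel" "disjoint_family F" "\<Union> (range F) \<in> sets borel"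
    have fin: "(\<Sum>i<n. u (F i)) \<le> u (\<Union>i<n. F i)" for n
    proof (induction n)
      case (Suc n)
      have "F i \<inter> F n = {}" if "i < n" for i
        using disjoint_family_onD[OF F(2) UNIV_I UNIV_I] that by simp
      then have "(\<Union>i<n. F i) \<inter> F n = {}" by auto
      then have le: "u (\<Union>i<n. F i) + u (F n) \<le> u ((\<Union>i<n. F i) \<union> F n)" by (rule super)
      have "(\<Union>i<n. F i) \<union> F n = (\<Union>i<Suc n. F i)" by (simp add: lessThan_Suc Un_commute)
      then show ?case using order_trans[OF add_right_mono[OF Suc] le] by (simp only: sum.lessThan_Suc)
    qed simp
    have "(\<Sum>i. u (F i)) \<le> u (\<Union> (range F))"
    proof (rule suminf_le_const)
      show "(\<Sum>i<n. u (F i)) \<le> u (\<Union> (range F))" for n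
        by (rule order_trans[OF fin mono]) auto
    qed simp
    moreover have "u (\<Union> (range F)) \<le> (\<Sum>i. u (F i))"
      unfolding u_def[of "\<Union> (range F)"]
    proof (rule SUP_least, clarify)
      fix B assume B: "B \<in> sets borel" "B \<subseteq> \<Union> (range F)"
      have s: "(\<lambda>i. m (B \<inter> F i)) sums m (\<Union>i. B \<inter> F i)"
        using F B by (intro ca_sums m) (auto simp: disjoint_family_on_def)
      have eq: "(\<Union>i. B \<inter> F i) = B" using B by auto
      have "(\<lambda>n. ennreal (\<Sum>i<n. m (B \<inter> F i))) \<longlonglongrightarrow> ennreal (m B)"
        using s unfolding sums_def eq by (rule tendsto_ennrealI)
      moreover have "ennreal (\<Sum>i<n. m (B \<inter> F i)) \<le> (\<Sum>i. u (F i))" for n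
      proof -
        have "ennreal (\<Sum>i<n. m (B \<inter> F i)) \<le> ennreal (\<Sum>i<n. max 0 (m (B \<inter> F i)))"
          by (intro ennreal_leI sum_mono) simp
        also have "\<dots> = (\<Sum>i<n. ennreal (max 0 (m (B \<inter> F i))))" by (simp add: sum_ennreal)
        also have "\<dots> = (\<Sum>i<n. ennreal (m (B \<inter> F i)))" by (intro sum.cong) (auto simp: max_def ennreal_neg)
        also have "\<dots> \<le> (\<Sum>i<n. u (F i))" using F B by (intro sum_mono up) auto
        also have "\<dots> \<le> (\<Sum>i. u (F i))" by (intro sum_le_suminf) auto
        finally show ?thesis .
      qed
      ultimately show "ennreal (m B) \<le> (\<Sum>i. u (F i))" by (intro LIMSEQ_le_const2) auto
    qed
    ultimately show "(\<Sum>i. u (F i)) = u (\<Union> (range F))" by (rule antisym)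
  qed
  moreover have "positive (sets borel) u" by (simp add: positive_def u_def m0)
  ultimately have "emeasure (measure_of UNIV (sets borel) u) A = u A"
    using sets.sigma_algebra_axioms[of borel] A by (intro emeasure_measure_of_sigma) simp_all
  then show ?thesis by (simp add: positive_part_def u_def[abs_def])
qed

text \<open>Consistency of the two encodings of a positive measure.\<close>

lemma measure_in_ca: "M \<in> ca_plus \<Longrightarrow> measure M \<in> ca"
  unfolding ca_plus_def ca_def
  by (auto intro: finite_measure.finite_measure_UNION)

lemma signed_integral_measure:
  assumes "M \<in> ca_plus"
  shows "signed_integral (measure M) f = integral\<^sup>L M f"
proof -
  interpret finite_measure M using assms by (simp add: ca_plus_def)
  have sets: "sets M = sets borel" using assms by (simp add: ca_plus_def)
  then have space: "space M = UNIV" by (metis sets_eq_imp_space_eq space_borel)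
  have "(SUP B\<in>{B \<in> sets borel. B \<subseteq> A}. ennreal (measure M B)) = emeasure M A"
    if "A \<in> sets borel" for A
    using that sets
    by (intro antisym SUP_least SUP_upper2[of A])
       (auto simp: emeasure_eq_measure intro!: ennreal_leI finite_measure_mono)
  then have "positive_part (measure M) = measure_of UNIV (sets borel) (emeasure M)"
    unfolding positive_part_def
    by (intro measure_of_eq) (auto simp: sets.sigma_sets_eq[of borel, simplified])
  also have "\<dots> = M" using measure_of_of_measure[of M] by (simp add: sets space)
  finally have pos: "positive_part (measure M) = M" .
  have "positive_part (\<lambda>A. - measure M A) = measure_of UNIV (sets borel) (\<lambda>A. 0)"
  proof -
    have "(SUP B\<in>{B \<in> sets borel. B \<subseteq> A}. ennreal (- measure M B)) = 0" for A
    proof -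
      have "ennreal (- measure M B) = 0" for B by (simp add: ennreal_neg)
      then show ?thesis by (auto simp: SUP_constant bot_ennreal)
    qed
    then show ?thesis unfolding positive_part_def by simp
  qed
  also have "\<dots> = null_measure borel"
    by (simp add: null_measure_def)
  finally show ?thesis by (simp add: signed_integral_def pos)
qed

section \<open>Conditions (A1)--(A5)\<close>

definition C_b :: "('a::topological_space \<Rightarrow> real) set" where
  "C_b = {f. continuous_on UNIV f \<and> bounded (range f)}"

definition cond_A1 :: "(real \<Rightarrow> 'a::metric_space \<Rightarrow> 'a measure) \<Rightarrow> bool" where
  "cond_A1 \<nu> \<longleftrightarrow>
     (\<exists>C::real. \<forall>t\<ge>0. \<forall>\<xi>. tv_norm (measure (\<nu> t \<xi>)) \<le> ennreal C) \<and>
     (\<forall>\<xi>. \<forall>\<Gamma>\<in>sets borel. measure (\<nu> 0 \<xi>) \<Gamma> = indicator \<Gamma> \<xi>)"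

definition cond_A2 :: "(real \<Rightarrow> 'a::metric_space \<Rightarrow> 'a measure) \<Rightarrow> bool" where
  "cond_A2 \<nu> \<longleftrightarrow> (\<forall>f\<in>C_b. \<forall>t\<ge>0. continuous_on UNIV (\<lambda>\<xi>. \<integral>\<xi>'. f \<xi>' \<partial>(\<nu> t \<xi>)))"

definition cond_A3 :: "(real \<Rightarrow> 'a::metric_space \<Rightarrow> 'a measure) \<Rightarrow> bool" where
  "cond_A3 \<nu> \<longleftrightarrow> (\<forall>f\<in>C_b. \<forall>t\<ge>0. \<forall>s\<ge>0. \<forall>\<xi>.
     (\<integral>\<xi>'. f \<xi>' \<partial>(\<nu> (t + s) \<xi>)) = (\<integral>\<xi>'. (\<integral>\<xi>''. f \<xi>'' \<partial>(\<nu> t \<xi>')) \<partial>(\<nu> s \<xi>)))"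

definition cond_A4 :: "(real \<Rightarrow> 'a::metric_space \<Rightarrow> 'a measure) \<Rightarrow> bool" where
  "cond_A4 \<nu> \<longleftrightarrow> (\<forall>t'>0. \<forall>K. compact K \<longrightarrow>
     (\<forall>\<epsilon>>0. \<exists>K0. compact K0 \<and>
       (\<forall>t\<in>{0..t'}. \<forall>\<xi>\<in>K. measure (\<nu> t \<xi>) K0 > measure (\<nu> t \<xi>) UNIV - \<epsilon>)))"

definition cond_A5 :: "(real \<Rightarrow> 'a::metric_space \<Rightarrow> 'a measure) \<Rightarrow> bool" where
  "cond_A5 \<nu> \<longleftrightarrow> (\<forall>r>0. \<forall>K. compact K \<and> K \<noteq> {} \<longrightarrow>
     ((\<lambda>t. SUP \<xi>\<in>K. \<bar>measure (\<nu> t \<xi>) (ball \<xi> r) - 1\<bar>) \<longlongrightarrow> 0) (at_right 0))"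

text \<open>\<open>\<mu>\<^sup>\<gamma>\<^sub>t(\<xi>, d\<xi>') = \<gamma>(\<xi>) \<gamma>(\<xi>')\<^sup>-\<^sup>1 \<mu>\<^sub>t(\<xi>, d\<xi>')\<close>\<close>

definition weighted_family ::
  "('a::metric_space \<Rightarrow> real) \<Rightarrow> (real \<Rightarrow> 'a \<Rightarrow> 'a measure) \<Rightarrow> real \<Rightarrow> 'a \<Rightarrow> 'a measure" where
  "weighted_family \<gamma> \<mu> t \<xi> =
     scale_measure (ennreal (\<gamma> \<xi>)) (density (\<mu> t \<xi>) (\<lambda>\<xi>'. ennreal (inverse (\<gamma> \<xi>'))))"

lemma emeasure_weighted_family:
  assumes "continuous_on UNIV \<gamma>" and "\<mu> t \<xi> \<in> ca_plus" and "\<Gamma> \<in> sets borel"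
  shows "emeasure (weighted_family \<gamma> \<mu> t \<xi>) \<Gamma> =
     ennreal (\<gamma> \<xi>) * (\<integral>\<^sup>+\<xi>'\<in>\<Gamma>. ennreal (inverse (\<gamma> \<xi>')) \<partial>(\<mu> t \<xi>))"
proof -
  have sets: "sets (\<mu> t \<xi>) = sets borel" using assms by (simp add: ca_plus_def)
  have "\<gamma> \<in> borel_measurable (\<mu> t \<xi>)"
    using borel_measurable_continuous_onI[OF assms(1)] measurable_cong_sets[OF sets refl] by blast
  then show ?thesis
    using assms(3) by (simp add: weighted_family_def emeasure_density sets)
qed

section \<open>The space \<open>C\<^sub>\<gamma>(E)\<close> and its topology\<close>

definition C_weighted :: "('a::metric_space \<Rightarrow> real) \<Rightarrow> ('a \<Rightarrow> real) set" where
  "C_weighted \<gamma> = {f. continuous_on UNIV f \<and> (\<lambda>x. f x * \<gamma> x) \<in> C_b}"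

definition weighted_seminorm ::
  "('a::metric_space \<Rightarrow> real) \<Rightarrow> 'a set \<Rightarrow> ('a set \<Rightarrow> real) \<Rightarrow> ('a \<Rightarrow> real) \<Rightarrow> real" where
  "weighted_seminorm \<gamma> K m f =
     (SUP x\<in>K. \<bar>f x * \<gamma> x\<bar>) + \<bar>signed_integral m (\<lambda>x. f x * \<gamma> x)\<bar>"

definition tau_weighted :: "('a::metric_space \<Rightarrow> real) \<Rightarrow> ('a \<Rightarrow> real) topology" where
  "tau_weighted \<gamma> = seminorm_topology (C_weighted \<gamma>)
     {weighted_seminorm \<gamma> K m | K m. compact K \<and> K \<noteq> {} \<and> m \<in> ca}"

lemma topspace_tau_weighted: "topspace (tau_weighted \<gamma>) = C_weighted \<gamma>"
proof -
  have ca0: "(\<lambda>A. 0) \<in> ca" by (simp add: ca_def)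
  have "f \<in> topspace (tau_weighted \<gamma>)" if f: "f \<in> C_weighted \<gamma>" for f
  proof -
    let ?p = "weighted_seminorm \<gamma> {undefined} (\<lambda>A. 0)"
    have "f \<in> {g \<in> C_weighted \<gamma>. ?p (g - f) < \<bar>?p (f - f)\<bar> + 1}" using f by simp
    moreover have "?p \<in> {weighted_seminorm \<gamma> K m | K m. compact K \<and> K \<noteq> {} \<and> m \<in> ca}"
      using ca0 by (intro CollectI exI[of _ "{undefined}"] exI[of _ "\<lambda>A. 0"]) simp
    moreover have "0 < \<bar>?p (f - f)\<bar> + 1" by linarith
    ultimately show ?thesis
      unfolding tau_weighted_def seminorm_topology_def topology_generated_by_topspace
      using f by blast
  qed
  moreover have "topspace (tau_weighted \<gamma>) \<subseteq> C_weighted \<gamma>"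
    unfolding tau_weighted_def seminorm_topology_def topology_generated_by_topspace by blast
  ultimately show ?thesis by blast
qed

definition transition_operator ::
  "(real \<Rightarrow> 'a \<Rightarrow> 'a measure) \<Rightarrow> real \<Rightarrow> ('a \<Rightarrow> real) \<Rightarrow> 'a \<Rightarrow> real" where
  "transition_operator \<mu> t f \<xi> = (\<integral>\<xi>'. f \<xi>' \<partial>(\<mu> t \<xi>))"

end

theory Submission
  imports Defs
begin

text \<open>
  Write \<open>\<nu>\<close> for the weighted family and \<open>S\<^sub>t g(\<xi>) = \<integral> g d\<nu>\<^sub>t(\<xi>)\<close>. Since \<open>\<gamma> T\<^sub>t f = S\<^sub>t (\<gamma> f)\<close>,
  multiplication by \<open>\<gamma>\<close> carries the problem to the semigroup \<open>S\<close> on the bounded continuous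
  functions, whose operators are bounded by one constant in the uniform norm.

  The topology is weak against all finite Borel measures, and on a general metric space such a measure
  need not be tight, so it sees points outside every compact set. Uniform smallness on compact sets is
  still enough to control it, provided the functions stay bounded: a failure of convergence against a
  measure along an indexed family already shows on a sequence of indices, and along a sequence the
  dominated convergence theorem applies. This is \<open>weighted_seminorm_small\<close>, and every convergence
  statement below is an instance of it: the limit \<open>t \<rightarrow> 0\<close>, equicontinuity (indexed by pairs of a
  time and a sequence index), convergence of Riemann sums (indexed by tagged divisions), and the limit
  \<open>a \<rightarrow> \<infinity>\<close> of the integrals over \<open>[0, a]\<close>.

  To apply it to a convergent sequence one needs the sequence to be bounded in the uniform norm. That is
  a uniform boundedness principle, \<open>uniform_boundedness_C_b\<close>: an unbounded sequence is resonant for a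
  suitable countable combination of point masses.

  What remains are estimates for \<open>S\<close> that are uniform on compact sets. Tightness (A4) turns smallness of
  \<open>g\<close> on a compact set into smallness of \<open>S\<^sub>t g\<close> on a given compact set, uniformly for bounded times
  (\<open>S_uniformly_small\<close>). Combining (A4) with (A5) shows that near time \<open>0\<close> the total mass of
  \<open>\<nu>\<^sub>t(\<xi>)\<close> is close to \<open>1\<close> and almost all of it lies near \<open>\<xi>\<close>; this gives \<open>S\<^sub>t g \<rightarrow> g\<close> uniformly on compact sets,
  and then, by the semigroup law, uniform continuity in time.

  The space need not be complete, so the existence of the integrals is not a formal consequence of continuity.
  The candidates are the pointwise integrals; they lie in the space because the integrand is jointly
  continuous and bounded.
\<close>

section \<open>Locally convex topologies generated by seminorms\<close>

locale seminorm_family =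
  fixes Z :: "'z::real_vector set" and P :: "('z \<Rightarrow> real) set"
  assumes subspace: "subspace Z"
    and nonempty: "P \<noteq> {}"
    and triangle: "\<And>p x y. p \<in> P \<Longrightarrow> x \<in> Z \<Longrightarrow> y \<in> Z \<Longrightarrow> p (x + y) \<le> p x + p y"
    and scale: "\<And>p c x. p \<in> P \<Longrightarrow> x \<in> Z \<Longrightarrow> p (c *\<^sub>R x) = \<bar>c\<bar> * p x"
    and separating: "\<And>x. x \<in> Z \<Longrightarrow> x \<noteq> 0 \<Longrightarrow> \<exists>p\<in>P. p x \<noteq> 0"
begin

abbreviation T where "T \<equiv> seminorm_topology Z P"

lemma zero: "p \<in> P \<Longrightarrow> p 0 = 0"
  using scale[of p 0 0] subspace_0[OF subspace] by simp

lemma minus: "p \<in> P \<Longrightarrow> x \<in> Z \<Longrightarrow> p (- x) = p x"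
  using scale[of p x "-1"] by simp

lemma nonneg: "p \<in> P \<Longrightarrow> x \<in> Z \<Longrightarrow> 0 \<le> p x"
  using triangle[of p x "- x"] minus[of p x] zero[of p] subspace_neg[OF subspace, of x] by simp

lemma diff: "x \<in> Z \<Longrightarrow> y \<in> Z \<Longrightarrow> x - y \<in> Z"
  by (rule subspace_diff[OF subspace])

lemma triangle_diff:
  "p \<in> P \<Longrightarrow> x \<in> Z \<Longrightarrow> y \<in> Z \<Longrightarrow> z \<in> Z \<Longrightarrow> p (x - z) \<le> p (x - y) + p (y - z)"
  using triangle[of p "x - y" "y - z"] diff by simp

lemma diff_commute: "p \<in> P \<Longrightarrow> x \<in> Z \<Longrightarrow> y \<in> Z \<Longrightarrow> p (x - y) = p (y - x)"
  using minus[of p "x - y"] diff by simp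

lemma openin_ball: "p \<in> P \<Longrightarrow> f \<in> Z \<Longrightarrow> 0 < e \<Longrightarrow> openin T {g \<in> Z. p (g - f) < e}"
  unfolding seminorm_topology_def by (rule topology_generated_by_Basis) blast

lemma topspace: "topspace T = Z"
proof
  show "topspace T \<subseteq> Z"
    unfolding seminorm_topology_def topology_generated_by_topspace by blast
  obtain p where p: "p \<in> P" using nonempty by blast
  show "Z \<subseteq> topspace T"
  proof
    fix f assume f: "f \<in> Z"
    have "f \<in> {g \<in> Z. p (g - f) < 1}" using f zero[OF p] by simp
    then show "f \<in> topspace T" using openin_subset[OF openin_ball[OF p f, of 1]] by auto
  qed
qed

lemma openin_finite_ball:
  assumes "finite Q" "Q \<subseteq> P" "f \<in> Z" "0 < e"
  shows "openin T {g \<in> Z. \<forall>p\<in>Q. p (g - f) < e}"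
  using assms
proof (induction Q)
  case empty
  then show ?case using openin_topspace[of T] by (simp add: topspace)
next
  case (insert p Q)
  have "{g \<in> Z. \<forall>q\<in>insert p Q. q (g - f) < e}
      = {g \<in> Z. p (g - f) < e} \<inter> {g \<in> Z. \<forall>p\<in>Q. p (g - f) < e}" by auto
  then show ?case using insert openin_ball[of p f e] by auto
qed

text \<open>Balls may be centred anywhere in the subbasis; the triangle inequality recentres them at \<open>z\<close>.\<close>

lemma finite_ball_subset:
  assumes "openin T V" "z \<in> V"
  shows "\<exists>Q e. finite Q \<and> Q \<subseteq> P \<and> 0 < e \<and> {g \<in> Z. \<forall>p\<in>Q. p (g - z) < e} \<subseteq> V"
proof -
  have "generate_topology_on {{g \<in> Z. p (g - f) < e} | p f e. p \<in> P \<and> f \<in> Z \<and> 0 < e} V"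
    using assms(1) unfolding seminorm_topology_def openin_topology_generated_by_iff .
  then show ?thesis using assms(2)
  proof induction
    case (Int a b)
    then obtain Q e Q' e' where "finite Q" "Q \<subseteq> P" "0 < e" "{g \<in> Z. \<forall>p\<in>Q. p (g - z) < e} \<subseteq> a"
      "finite Q'" "Q' \<subseteq> P" "0 < e'" "{g \<in> Z. \<forall>p\<in>Q'. p (g - z) < e'} \<subseteq> b"
      by auto
    then show ?case
      by (intro exI[of _ "Q \<union> Q'"] exI[of _ "min e e'"]) auto
  next
    case (UN K)
    then obtain k where "k \<in> K" "z \<in> k" by auto
    with UN.IH show ?case by (meson Sup_upper order_trans)
  next
    case (Basis s)
    then obtain p f e where s: "s = {g \<in> Z. p (g - f) < e}" "p \<in> P" "f \<in> Z" "0 < e" by blast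
    then have z: "z \<in> Z" "p (z - f) < e" using Basis by auto
    have "{g \<in> Z. \<forall>q\<in>{p}. q (g - z) < e - p (z - f)} \<subseteq> s"
    proof
      fix g assume "g \<in> {g \<in> Z. \<forall>q\<in>{p}. q (g - z) < e - p (z - f)}"
      then show "g \<in> s" using triangle_diff[of p g z f] s z by auto
    qed
    then show ?case using s z by (intro exI[of _ "{p}"] exI[of _ "e - p (z - f)"]) auto
  qed simp
qed

text \<open>Stated for an arbitrary filter, so that limits, uniform convergence of a family of operators and
  convergence of Riemann sums all reduce to the individual seminorms in the same way.\<close>

lemma eventually_in_nbhd:
  assumes small: "\<And>p e. p \<in> P \<Longrightarrow> 0 < e \<Longrightarrow> eventually (\<lambda>i. p (x i - y i) < e) F"
    and Z: "eventually (\<lambda>i. x i - y i \<in> Z) F"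
    and U: "nbhd_in T 0 U"
  shows "eventually (\<lambda>i. x i - y i \<in> U) F"
proof -
  obtain V where V: "openin T V" "0 \<in> V" "V \<subseteq> U" using U by (auto simp: nbhd_in_def)
  then obtain Q e where Q: "finite Q" "Q \<subseteq> P" "0 < e" "{g \<in> Z. \<forall>p\<in>Q. p (g - 0) < e} \<subseteq> V"
    using finite_ball_subset[OF V(1,2)] by auto
  have "eventually (\<lambda>i. \<forall>p\<in>Q. p (x i - y i) < e) F"
    using Q by (intro eventually_ball_finite ballI small) auto
  with Z show ?thesis
    by eventually_elim (use Q V in auto)
qed

lemma nbhd_in_translate:
  assumes U: "nbhd_in T z U"
  shows "nbhd_in T 0 ((\<lambda>u. u - z) ` U)"
proof -
  obtain V where V: "openin T V" "z \<in> V" "V \<subseteq> U" using U by (auto simp: nbhd_in_def)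
  have z: "z \<in> Z" and UZ: "U \<subseteq> Z" using V U openin_subset[OF V(1)] by (auto simp: topspace nbhd_in_def)
  obtain Q e where Q: "finite Q" "Q \<subseteq> P" "0 < e" "{g \<in> Z. \<forall>p\<in>Q. p (g - z) < e} \<subseteq> V"
    using finite_ball_subset[OF V(1,2)] by auto
  have 0: "0 \<in> Z" by (rule subspace_0[OF subspace])
  have "{g \<in> Z. \<forall>p\<in>Q. p (g - 0) < e} \<subseteq> (\<lambda>u. u - z) ` U"
  proof
    fix g assume g: "g \<in> {g \<in> Z. \<forall>p\<in>Q. p (g - 0) < e}"
    then have "g + z \<in> {g \<in> Z. \<forall>p\<in>Q. p (g - z) < e}" using z subspace_add[OF subspace] by auto
    then have "g + z \<in> U" using Q(4) V(3) by blast
    then show "g \<in> (\<lambda>u. u - z) ` U" by (intro image_eqI[of _ _ "g + z"]) auto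
  qed
  moreover have "(\<lambda>u. u - z) ` U \<subseteq> Z" using UZ z diff by auto
  moreover have "p (0 - 0) < e" if "p \<in> Q" for p using zero[of p] that Q(2,3) by auto
  then have "0 \<in> {g \<in> Z. \<forall>p\<in>Q. p (g - 0) < e}" using 0 by simp
  ultimately show ?thesis
    unfolding nbhd_in_def topspace using openin_finite_ball[OF Q(1,2) 0 Q(3)] by (intro conjI exI)
qed

lemma limitin_iff:
  "limitin T x y F \<longleftrightarrow>
     y \<in> Z \<and> eventually (\<lambda>i. x i \<in> Z) F \<and> (\<forall>p\<in>P. \<forall>e>0. eventually (\<lambda>i. p (x i - y) < e) F)"
proof (intro iffI conjI ballI allI impI)
  assume L: "limitin T x y F"
  show y: "y \<in> Z" using limitin_topspace[OF L] by (simp add: topspace)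
  show "eventually (\<lambda>i. x i \<in> Z) F"
    using limitinD[OF L openin_topspace] y by (simp add: topspace)
  fix p and e :: real assume "p \<in> P" "0 < e"
  then show "eventually (\<lambda>i. p (x i - y) < e) F"
    using limitinD[OF L openin_ball[of p y e]] y zero[of p] by (auto elim: eventually_mono)
next
  assume R: "y \<in> Z \<and> eventually (\<lambda>i. x i \<in> Z) F \<and> (\<forall>p\<in>P. \<forall>e>0. eventually (\<lambda>i. p (x i - y) < e) F)"
  then have D: "eventually (\<lambda>i. x i - y \<in> Z) F" by (auto elim: eventually_mono intro: diff)
  show "limitin T x y F"
    unfolding limitin_def topspace
  proof (intro conjI allI impI)
    fix U assume U: "openin T U \<and> y \<in> U"
    then have "nbhd_in T y U" unfolding nbhd_in_def using openin_subset[of T U] by blast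
    then have "eventually (\<lambda>i. x i - y \<in> (\<lambda>u. u - y) ` U) F"
      using R by (intro eventually_in_nbhd[OF _ D nbhd_in_translate]) simp_all
    then show "eventually (\<lambda>i. x i \<in> U) F" by eventually_elim auto
  qed (use R in simp)
qed

lemma hausdorff_lcs: "hausdorff_lcs T"
  unfolding hausdorff_lcs_def topspace
proof (intro conjI)
  show "subspace Z" by (rule subspace)
  show "continuous_map (prod_topology T T) T (\<lambda>(x, y). x + y)"
    unfolding continuous_map_atin limitin_iff
  proof (intro ballI conjI)
    fix a assume a: "a \<in> topspace (prod_topology T T)"
    obtain u v where uv: "a = (u, v)" "u \<in> Z" "v \<in> Z" using a by (auto simp: topspace)
    show "(case a of (x, y) \<Rightarrow> x + y) \<in> Z" using uv subspace_add[OF subspace] by auto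
    have fst: "limitin T fst u (atin (prod_topology T T) a)"
      using continuous_map_fst[of T T] a uv unfolding continuous_map_atin by fastforce
    have snd: "limitin T snd v (atin (prod_topology T T) a)"
      using continuous_map_snd[of T T] a uv unfolding continuous_map_atin by fastforce
    have ev: "eventually (\<lambda>w. fst w \<in> Z \<and> snd w \<in> Z) (atin (prod_topology T T) a)"
      using fst snd unfolding limitin_iff by (auto simp: eventually_conj_iff)
    then show "eventually (\<lambda>w. (case w of (x, y) \<Rightarrow> x + y) \<in> Z) (atin (prod_topology T T) a)"
      by eventually_elim (auto intro: subspace_add[OF subspace] simp: case_prod_beta)
    fix p assume "p \<in> P"
    show "\<forall>e>0. eventually (\<lambda>w. p ((case w of (x, y) \<Rightarrow> x + y) - (case a of (x, y) \<Rightarrow> x + y)) < e)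
        (atin (prod_topology T T) a)"
    proof (intro allI impI)
      fix e :: real assume "0 < e"
      with \<open>p \<in> P\<close> have p: "p \<in> P" "0 < e" by auto
      have "eventually (\<lambda>w. p (fst w - u) < e/2 \<and> p (snd w - v) < e/2) (atin (prod_topology T T) a)"
        using fst snd p half_gt_zero[OF p(2)] unfolding limitin_iff eventually_conj_iff by blast
      with ev show "eventually (\<lambda>w. p ((case w of (x, y) \<Rightarrow> x + y) - (case a of (x, y) \<Rightarrow> x + y)) < e)
        (atin (prod_topology T T) a)"
      proof eventually_elim
        case (elim w)
        have "p ((fst w + snd w) - (u + v)) = p ((fst w - u) + (snd w - v))" by (simp add: algebra_simps)
        also have "\<dots> \<le> p (fst w - u) + p (snd w - v)" using elim uv p by (intro triangle diff) auto
        finally show ?case using elim uv by (simp add: case_prod_beta)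
      qed
    qed
  qed
  show "continuous_map (prod_topology euclideanreal T) T (\<lambda>(c, x). c *\<^sub>R x)"
    unfolding continuous_map_atin limitin_iff
  proof (intro ballI conjI)
    let ?A = "prod_topology euclideanreal T"
    fix a assume a: "a \<in> topspace ?A"
    obtain c v where cv: "a = (c, v)" "v \<in> Z" using a by (auto simp: topspace)
    show "(case a of (x, y) \<Rightarrow> x *\<^sub>R y) \<in> Z" using cv subspace_scale[OF subspace] by auto
    have fst: "limitin euclideanreal fst c (atin ?A a)"
      using continuous_map_fst[of euclideanreal T] a cv unfolding continuous_map_atin by fastforce
    have snd: "limitin T snd v (atin ?A a)"
      using continuous_map_snd[of euclideanreal T] a cv unfolding continuous_map_atin by fastforce
    have ev: "eventually (\<lambda>w. snd w \<in> Z) (atin ?A a)" using snd unfolding limitin_iff by simp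
    then show "eventually (\<lambda>w. (case w of (x, y) \<Rightarrow> x *\<^sub>R y) \<in> Z) (atin ?A a)"
      by eventually_elim (auto intro: subspace_scale[OF subspace] simp: case_prod_beta)
    fix p assume "p \<in> P"
    show "\<forall>e>0. eventually (\<lambda>w. p ((case w of (x, y) \<Rightarrow> x *\<^sub>R y) - (case a of (x, y) \<Rightarrow> x *\<^sub>R y)) < e)
        (atin ?A a)"
    proof (intro allI impI)
      fix e :: real assume "0 < e"
      with \<open>p \<in> P\<close> have p: "p \<in> P" "0 < e" by auto
      have f: "(fst \<longlongrightarrow> c) (atin ?A a)" using fst by (simp add: limitin_canonical_iff)
      have s: "((\<lambda>w. p (snd w - v)) \<longlongrightarrow> 0) (atin ?A a)"
      proof (rule tendstoI)
        fix d :: real assume "0 < d"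
        then have "eventually (\<lambda>w. p (snd w - v) < d) (atin ?A a)"
          using snd p unfolding limitin_iff by simp
        with ev show "eventually (\<lambda>w. dist (p (snd w - v)) 0 < d) (atin ?A a)"
          by eventually_elim (use nonneg[OF p(1) diff] cv in \<open>auto simp: dist_real_def\<close>)
      qed
      have "((\<lambda>w. \<bar>fst w\<bar> * p (snd w - v) + \<bar>fst w - c\<bar> * p v) \<longlongrightarrow> \<bar>c\<bar> * 0 + \<bar>c - c\<bar> * p v) (atin ?A a)"
        by (intro tendsto_intros f s)
      then have "eventually (\<lambda>w. \<bar>fst w\<bar> * p (snd w - v) + \<bar>fst w - c\<bar> * p v < e) (atin ?A a)"
        using p by (intro order_tendstoD(2)) auto
      with ev show "eventually (\<lambda>w. p ((case w of (x, y) \<Rightarrow> x *\<^sub>R y) - (case a of (x, y) \<Rightarrow> x *\<^sub>R y)) < e)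
        (atin ?A a)"
      proof eventually_elim
        case (elim w)
        have "p (fst w *\<^sub>R snd w - c *\<^sub>R v) = p (fst w *\<^sub>R (snd w - v) + (fst w - c) *\<^sub>R v)"
          by (simp add: algebra_simps)
        also have "\<dots> \<le> p (fst w *\<^sub>R (snd w - v)) + p ((fst w - c) *\<^sub>R v)"
          using elim cv p by (intro triangle diff subspace_scale[OF subspace]) auto
        also have "\<dots> = \<bar>fst w\<bar> * p (snd w - v) + \<bar>fst w - c\<bar> * p v"
          using elim cv p by (simp add: scale diff)
        finally show ?case using elim cv by (simp add: case_prod_beta)
      qed
    qed
  qed
  show "neighbourhood_base_of convex T"
    unfolding neighbourhood_base_of
  proof (intro allI impI)
    fix W x assume "openin T W \<and> x \<in> W"
    then have W: "openin T W" "x \<in> W" by auto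
    then have x: "x \<in> Z" using openin_subset[of T W] by (auto simp: topspace)
    obtain Q e where Q: "finite Q" "Q \<subseteq> P" "0 < e" "{g \<in> Z. \<forall>p\<in>Q. p (g - x) < e} \<subseteq> W"
      using finite_ball_subset[OF W] by auto
    let ?V = "{g \<in> Z. \<forall>p\<in>Q. p (g - x) < e}"
    have "p (x - x) < e" if "p \<in> Q" for p using zero[of p] that Q(2,3) by auto
    then have "x \<in> ?V" using x by simp
    have "convex ?V"
    proof (rule convexI)
      fix g h and u v :: real
      assume gh: "g \<in> ?V" "h \<in> ?V" and uv: "0 \<le> u" "0 \<le> v" "u + v = 1"
      have "p (u *\<^sub>R g + v *\<^sub>R h - x) < e" if p: "p \<in> Q" for p
      proof -
        have pP: "p \<in> P" using p Q by auto
        have "x = u *\<^sub>R x + v *\<^sub>R x" using uv by (simp flip: scaleR_add_left)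
        then have "u *\<^sub>R g + v *\<^sub>R h - x = u *\<^sub>R (g - x) + v *\<^sub>R (h - x)" by (simp add: algebra_simps)
        then have "p (u *\<^sub>R g + v *\<^sub>R h - x) \<le> p (u *\<^sub>R (g - x)) + p (v *\<^sub>R (h - x))"
          using gh x pP by (auto intro!: triangle diff subspace_scale[OF subspace])
        also have "\<dots> = u * p (g - x) + v * p (h - x)"
          using gh x pP uv by (simp add: scale diff)
        also have "\<dots> < e" using gh p uv by (intro convex_bound_lt) auto
        finally show ?thesis .
      qed
      then show "u *\<^sub>R g + v *\<^sub>R h \<in> ?V"
        using gh by (auto intro: subspace_add[OF subspace] subspace_scale[OF subspace])
    qed
    then show "\<exists>U V. openin T U \<and> convex V \<and> x \<in> U \<and> U \<subseteq> V \<and> V \<subseteq> W"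
      using openin_finite_ball[OF Q(1,2) x Q(3)] Q(4) \<open>x \<in> ?V\<close> by blast
  qed
  show "Hausdorff_space T"
    unfolding Hausdorff_space_def topspace
  proof (intro allI impI, elim conjE)
    fix x y assume xy: "x \<in> Z" "y \<in> Z" "x \<noteq> y"
    then obtain p where p: "p \<in> P" "p (x - y) \<noteq> 0" using separating[of "x - y"] diff by auto
    define e where "e = p (x - y) / 2"
    have e: "0 < e" using p nonneg[OF p(1) diff[OF xy(1,2)]] by (simp add: e_def)
    have "disjnt {g \<in> Z. p (g - x) < e} {g \<in> Z. p (g - y) < e}"
      unfolding disjnt_iff
    proof (intro allI notI, elim conjE)
      fix g assume g: "g \<in> {g \<in> Z. p (g - x) < e}" "g \<in> {g \<in> Z. p (g - y) < e}"
      then have "p (x - y) \<le> p (g - x) + p (g - y)"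
        using triangle_diff[OF p(1) xy(1) _ xy(2)] diff_commute[OF p(1) xy(1)] by simp
      then show False using g by (simp add: e_def)
    qed
    then show "\<exists>U V. openin T U \<and> openin T V \<and> x \<in> U \<and> y \<in> V \<and> disjnt U V"
      using openin_ball[OF p(1) xy(1) e] openin_ball[OF p(1) xy(2) e] xy e zero[OF p(1)]
      by (intro exI[of _ "{g \<in> Z. p (g - x) < e}"] exI[of _ "{g \<in> Z. p (g - y) < e}"]) simp
  qed
qed

lemma seq_equicontinuousI:
  assumes maps: "\<And>i. i \<in> I \<Longrightarrow> F i \<in> Z \<rightarrow> Z"
    and small: "\<And>zs z p e. (\<And>n. zs n \<in> Z) \<Longrightarrow> limitin T zs z sequentially \<Longrightarrow> p \<in> P \<Longrightarrow> 0 < e \<Longrightarrow>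
      \<exists>N. \<forall>i\<in>I. \<forall>n\<ge>N. p (F i (zs n) - F i z) < e"
  shows "seq_equicontinuous T I F"
  unfolding seq_equicontinuous_def topspace
proof (intro conjI ballI allI impI)
  show "i \<in> I \<Longrightarrow> F i \<in> Z \<rightarrow> Z" for i by (rule maps)
  fix zs z U
  assume zs: "(\<forall>n. zs n \<in> Z) \<and> limitin T zs z sequentially" and U: "nbhd_in T 0 U"
  have z: "z \<in> Z" using zs by (simp add: limitin_iff)
  \<comment> \<open>Uniformity in the operator is encoded in a filter on pairs (operator, sequence index).\<close>
  let ?F = "INF N. principal (I \<times> {N::nat..})"
  have ev: "eventually R ?F \<longleftrightarrow> (\<exists>N. \<forall>i\<in>I. \<forall>n\<ge>N. R (i, n))" for R
      proof (subst eventually_INF_base)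
    show "\<exists>x\<in>UNIV. principal (I \<times> {x..}) \<le> inf (principal (I \<times> {M..})) (principal (I \<times> {N..}))" for M N :: nat
      by (intro bexI[of _ "max M N"]) auto
  qed (auto simp: eventually_principal)
  have "eventually (\<lambda>w. F (fst w) (zs (snd w)) - F (fst w) z \<in> U) ?F"
  proof (rule eventually_in_nbhd[OF _ _ U])
    show "eventually (\<lambda>w. p (F (fst w) (zs (snd w)) - F (fst w) z) < e) ?F" if "p \<in> P" "0 < e" for p e
      using small[of zs z p e] zs that unfolding ev by simp
    show "eventually (\<lambda>w. F (fst w) (zs (snd w)) - F (fst w) z \<in> Z) ?F"
      unfolding ev using maps zs z by (auto intro!: diff)
  qed
  then obtain N where N: "\<And>i n. i \<in> I \<Longrightarrow> N \<le> n \<Longrightarrow> F i (zs n) - F i z \<in> U" unfolding ev by auto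
  have "F i (zs n) \<in> (\<lambda>u. F i z + u) ` U" if "i \<in> I" "N \<le> n" for i n
    by (rule image_eqI[OF _ N[OF that]]) simp
  then show "\<exists>N. \<forall>i\<in>I. \<forall>n\<ge>N. F i (zs n) \<in> (\<lambda>u. F i z + u) ` U"
    by (intro exI[of _ N] ballI allI impI)
qed

lemma has_riemann_integralI:
  fixes F :: "real \<Rightarrow> 'z"
  assumes J: "J \<in> Z" and F: "\<And>x. x \<in> {a..b} \<Longrightarrow> F x \<in> Z"
    and small: "\<And>p e. p \<in> P \<Longrightarrow> 0 < e \<Longrightarrow>
      \<exists>d>0. \<forall>D. D tagged_division_of {a..b} \<and> (\<forall>(x, k)\<in>D. measure lborel k < d) \<longrightarrow>
         p ((\<Sum>(x, k)\<in>D. measure lborel k *\<^sub>R F x) - J) < e"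
  shows "has_riemann_integral T F J a b"
  unfolding has_riemann_integral_def topspace
proof (intro conjI allI impI)
  fix U assume U: "nbhd_in T J U"
  define A :: "real \<Rightarrow> (real \<times> real set) set set" where
    "A d = {D. D tagged_division_of {a..b} \<and> (\<forall>(x, k)\<in>D. measure lborel k < d)}" for d
  \<comment> \<open>The sets \<open>A d\<close> are the base of the filter along which Riemann sums converge.\<close>
  have A_mono: "A c \<subseteq> A d" if "c \<le> d" for c d
  proof
    fix D assume "D \<in> A c"
    then have t: "D tagged_division_of {a..b}" and m: "\<forall>w\<in>D. measure lborel (snd w) < c"
      unfolding A_def by (simp_all add: case_prod_beta)
    have "\<forall>w\<in>D. measure lborel (snd w) < d" using m that by fastforce
    with t show "D \<in> A d" unfolding A_def by (simp add: case_prod_beta)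
  qed
  define S where "S (D :: (real \<times> real set) set) = (\<Sum>(x, k)\<in>D. measure lborel k *\<^sub>R F x)" for D
  let ?F = "INF d\<in>{0<..}. principal (A d)"
  have ev: "eventually R ?F \<longleftrightarrow> (\<exists>d>0. \<forall>D\<in>A d. R D)" for R
  proof (subst eventually_INF_base)
    show "\<exists>x\<in>{0<..}. principal (A x) \<le> inf (principal (A c)) (principal (A d))"
      if "c \<in> {0<..}" "d \<in> {0<..}" for c d :: real
      using that A_mono[of "min c d" c] A_mono[of "min c d" d] by (intro bexI[of _ "min c d"]) auto
  qed (auto simp: eventually_principal)
  have "eventually (\<lambda>D. S D - J \<in> (\<lambda>u. u - J) ` U) ?F"
  proof (rule eventually_in_nbhd[OF _ _ nbhd_in_translate[OF U]])
    show "eventually (\<lambda>D. p (S D - J) < e) ?F" if "p \<in> P" "0 < e" for p e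
      using small[OF that] unfolding ev unfolding A_def S_def by blast
    have "S D - J \<in> Z" if D: "D tagged_division_of {a..b}" for D
    proof -
      have "measure lborel k *\<^sub>R F x \<in> Z" if "(x, k) \<in> D" for x k
        by (intro subspace_scale[OF subspace] F tag_in_interval[OF D that])
      then show ?thesis
        unfolding S_def by (intro diff subspace_sum[OF subspace] J) (simp add: case_prod_beta)
    qed
    then show "eventually (\<lambda>D. S D - J \<in> Z) ?F"
      unfolding ev unfolding A_def by (intro exI[of _ 1]) simp
  qed
  then obtain d where d: "0 < d" "\<And>D. D \<in> A d \<Longrightarrow> S D - J \<in> (\<lambda>u. u - J) ` U"
    unfolding ev by blast
  have "S D \<in> U" if "D \<in> A d" for D
  proof -
    obtain u where "u \<in> U" "S D - J = u - J" using d(2)[OF \<open>D \<in> A d\<close>] by blast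
    then show ?thesis by simp
  qed
  then show "\<exists>d>0. \<forall>D. D tagged_division_of {a..b} \<and> (\<forall>(x, k)\<in>D. measure lborel k < d) \<longrightarrow>
      (\<Sum>(x, k)\<in>D. measure lborel k *\<^sub>R F x) \<in> U"
    using d(1) unfolding A_def S_def by blast
qed (rule J)

end

section \<open>Finite signed measures\<close>

text \<open>A set on which \<open>m\<close> is unbounded splits into two pieces on which \<open>\<bar>m\<bar>\<close> is large, and \<open>m\<close> is unbounded
  on one of them. Iterating gives a decreasing sequence of sets along which \<open>\<bar>m\<bar>\<close> tends to infinity,
  although \<open>m\<close> converges along it by countable additivity.\<close>

lemma ca_bounded:
  fixes m :: "'a::topological_space set \<Rightarrow> real"
  assumes m: "m \<in> ca"
  shows "\<exists>C. \<forall>B\<in>sets borel. \<bar>m B\<bar> \<le> C"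
proof (rule ccontr)
  define wild where "wild A \<longleftrightarrow> A \<in> sets borel \<and> (\<forall>C. \<exists>B\<in>sets borel. B \<subseteq> A \<and> C < \<bar>m B\<bar>)"
    for A :: "'a set"
  have split: "m X = m (X \<inter> B) + m (X - B)" if "X \<in> sets borel" "B \<in> sets borel" for X B
    using ca_Un[OF m, of "X \<inter> B" "X - B"] that by (simp add: Int_Diff_Un Int_Diff_disjoint)
  have tame: "\<exists>C. \<forall>X. X \<in> sets borel \<longrightarrow> X \<subseteq> Y \<longrightarrow> \<bar>m X\<bar> \<le> C"
    if "\<not> wild Y" "Y \<in> sets borel" for Y
    using that unfolding wild_def by (meson not_le)
  have step: "\<exists>A'. wild A' \<and> A' \<subseteq> A \<and> real n \<le> \<bar>m A'\<bar>" if A: "wild A" for A n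
  proof -
    obtain B where B: "B \<in> sets borel" "B \<subseteq> A" "\<bar>m A\<bar> + real n < \<bar>m B\<bar>"
      using A[unfolded wild_def, THEN conjunct2, rule_format, of "\<bar>m A\<bar> + real n"] by blast
    have Ab: "A \<in> sets borel" using A by (simp add: wild_def)
    have "m A = m B + m (A - B)" using split[OF Ab B(1)] B(2) by (simp add: Int_absorb1)
    then have diff: "real n \<le> \<bar>m (A - B)\<bar>"
      using B(3) abs_triangle_ineq4[of "m A" "m (A - B)"] by simp
    have "wild B \<or> wild (A - B)"
    proof (rule ccontr)
      assume "\<not> (wild B \<or> wild (A - B))"
      then obtain C1 C2 where C: "\<And>X. X \<in> sets borel \<Longrightarrow> X \<subseteq> B \<Longrightarrow> \<bar>m X\<bar> \<le> C1"
        "\<And>X. X \<in> sets borel \<Longrightarrow> X \<subseteq> A - B \<Longrightarrow> \<bar>m X\<bar> \<le> C2"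
        using tame[of B] tame[of "A - B"] B(1) Ab by auto
      obtain X where X: "X \<in> sets borel" "X \<subseteq> A" "C1 + C2 < \<bar>m X\<bar>"
        using A[unfolded wild_def, THEN conjunct2, rule_format, of "C1 + C2"] by blast
      have "\<bar>m (X \<inter> B)\<bar> \<le> C1" "\<bar>m (X - B)\<bar> \<le> C2" using X B by (auto intro!: C)
      then show False using split[OF X(1) B(1)] X(3) by linarith
    qed
    then show ?thesis
    proof
      assume "wild B"
      then show ?thesis using B by (intro exI[of _ B]) linarith
    next
      assume "wild (A - B)"
      then show ?thesis using diff by (intro exI[of _ "A - B"]) blast
    qed
  qed
  assume "\<nexists>C. \<forall>B\<in>sets borel. \<bar>m B\<bar> \<le> C"
  then have "wild UNIV" unfolding wild_def by (auto simp: not_le)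
  then obtain A where A: "\<And>n. wild (A n)" "\<And>n. A (Suc n) \<subseteq> A n" "\<And>n. real n \<le> \<bar>m (A (Suc n))\<bar>"
    using dependent_nat_choice[of "\<lambda>n. wild" "\<lambda>n X Y. Y \<subseteq> X \<and> real n \<le> \<bar>m Y\<bar>"] step by metis
  have Ab: "A n \<in> sets borel" for n using A(1) by (simp add: wild_def)
  have "(- A (Suc n)) - (- A n) = A n - A (Suc n)" for n by blast
  then have "disjoint_family (\<lambda>n. A n - A (Suc n))"
    using disjoint_family_Suc[of "\<lambda>n. - A n"] A(2) by simp
  then have sums: "(\<lambda>n. m (A n - A (Suc n))) sums m (\<Union>n. A n - A (Suc n))"
    by (intro ca_sums[OF m]) (use Ab in auto)
  have "m (A n - A (Suc n)) = m (A n) - m (A (Suc n))" for n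
    using split[OF Ab Ab, of n "Suc n"] A(2)[of n] by (simp add: Int_absorb1)
  then have "(\<Sum>n<N. m (A n - A (Suc n))) = m (A 0) - m (A N)" for N
    by (simp add: sum_lessThan_telescope'[of "\<lambda>n. m (A n)"])
  then have "(\<lambda>N. m (A 0) - m (A N)) \<longlonglongrightarrow> m (\<Union>n. A n - A (Suc n))"
    using sums by (simp add: sums_def)
  then have "(\<lambda>N. m (A 0) - (m (A 0) - m (A N))) \<longlonglongrightarrow> m (A 0) - m (\<Union>n. A n - A (Suc n))"
    by (intro tendsto_intros)
  then have "Bseq (\<lambda>N. m (A N))" by (intro convergent_imp_Bseq convergentI) simp
  then obtain C where C: "\<And>n. \<bar>m (A n)\<bar> \<le> C" unfolding Bseq_def by auto
  obtain n where "C < real n" using reals_Archimedean2 by blast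
  then show False using A(3)[of n] C[of "Suc n"] by linarith
qed

lemma uminus_in_ca: "m \<in> ca \<Longrightarrow> (\<lambda>A. - m A) \<in> ca"
  unfolding ca_def by (auto intro: sums_minus)

text \<open>The integral against a signed measure is therefore a difference of two integrals against finite
  positive measures, for which dominated convergence is available.\<close>

lemma positive_part_in_ca_plus:
  fixes m :: "'a::topological_space set \<Rightarrow> real"
  assumes m: "m \<in> ca"
  shows "positive_part m \<in> ca_plus"
proof -
  obtain C where C: "\<And>B. B \<in> sets borel \<Longrightarrow> \<bar>m B\<bar> \<le> C" using ca_bounded[OF m] by blast
  have space: "space (positive_part m) = UNIV"
    unfolding positive_part_def by (simp add: space_measure_of_conv)
  have "sets (positive_part m) = sets borel"
    unfolding positive_part_def using sets.sigma_sets_eq[of "borel :: 'a measure"]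
    by (subst sets_measure_of) auto
  moreover have "emeasure (positive_part m) UNIV \<le> ennreal C"
    unfolding emeasure_positive_part[OF m, of UNIV, simplified]
    by (intro SUP_least ennreal_leI) (use C in \<open>auto intro: abs_le_D1\<close>)
  then have "emeasure (positive_part m) (space (positive_part m)) \<noteq> \<infinity>"
    using space by (auto simp: top_unique)
  then have "finite_measure (positive_part m)" by (rule finite_measureI)
  ultimately show ?thesis unfolding ca_plus_def by simp
qed

lemma C_b_boundE:
  assumes "g \<in> C_b"
  obtains B where "0 \<le> B" "\<And>x. \<bar>g x\<bar> \<le> B"
proof -
  obtain B where "\<forall>x\<in>range g. norm x \<le> B" using assms unfolding C_b_def bounded_iff by blast
  then have "\<bar>g x\<bar> \<le> max 0 B" for x by (simp add: max.coboundedI2)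
  then show thesis by (intro that[of "max 0 B"]) simp_all
qed

lemma C_bI: "continuous_on UNIV g \<Longrightarrow> (\<And>x. \<bar>g x\<bar> \<le> B) \<Longrightarrow> g \<in> C_b"
  unfolding C_b_def bounded_iff by auto

lemma measurable_ca_plus:
  fixes M :: "'a::topological_space measure" and g :: "'a \<Rightarrow> real"
  assumes "M \<in> ca_plus" "continuous_on UNIV g"
  shows "g \<in> borel_measurable M"
  using borel_measurable_continuous_onI[OF assms(2)] assms(1)
    measurable_cong_sets[of M borel borel borel] by (auto simp: ca_plus_def)

lemma space_ca_plus: "M \<in> ca_plus \<Longrightarrow> space M = UNIV"
  by (metis (mono_tags, lifting) ca_plus_def mem_Collect_eq sets_eq_imp_space_eq space_borel)

lemma integrable_C_b:
  fixes M :: "'a::topological_space measure"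
  assumes M: "M \<in> ca_plus" and g: "g \<in> C_b"
  shows "integrable M g"
proof -
  interpret finite_measure M using M by (simp add: ca_plus_def)
  obtain B where "\<And>x. \<bar>g x\<bar> \<le> B" using C_b_boundE[OF g] by metis
  then show ?thesis
    by (intro integrable_const_bound[of _ B] measurable_ca_plus M) (use g in \<open>auto simp: C_b_def\<close>)
qed

lemma C_b_add: "f \<in> C_b \<Longrightarrow> g \<in> C_b \<Longrightarrow> (\<lambda>x. f x + g x) \<in> C_b"
  unfolding C_b_def by (auto intro: continuous_on_add bounded_plus_comp)

lemma C_b_cmult: "g \<in> C_b \<Longrightarrow> (\<lambda>x. c * g x) \<in> C_b"
  unfolding C_b_def
  by (auto intro: continuous_on_mult_left bounded_scaling[of "range g" c, simplified image_image, simplified])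

lemma signed_integral_add:
  assumes "m \<in> ca" "f \<in> C_b" "g \<in> C_b"
  shows "signed_integral m (\<lambda>x. f x + g x) = signed_integral m f + signed_integral m g"
  using assms uminus_in_ca[of m] unfolding signed_integral_def
  by (simp add: Bochner_Integration.integral_add integrable_C_b positive_part_in_ca_plus)

lemma signed_integral_cmult:
  "signed_integral m (\<lambda>x. c * g x) = c * signed_integral m g"
  unfolding signed_integral_def by (simp add: right_diff_distrib)

section \<open>The weighted topology\<close>

definition weighted_seminorms :: "('a::metric_space \<Rightarrow> real) \<Rightarrow> (('a \<Rightarrow> real) \<Rightarrow> real) set" where
  "weighted_seminorms \<gamma> = {weighted_seminorm \<gamma> K m | K m. compact K \<and> K \<noteq> {} \<and> m \<in> ca}"

lemma tau_weighted_eq: "tau_weighted \<gamma> = seminorm_topology (C_weighted \<gamma>) (weighted_seminorms \<gamma>)"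
  by (simp add: tau_weighted_def weighted_seminorms_def)

lemma weighted_C_b: "f \<in> C_weighted \<gamma> \<Longrightarrow> (\<lambda>x. f x * \<gamma> x) \<in> C_b"
  by (simp add: C_weighted_def)

lemma weighted_bdd_above:
  assumes "f \<in> C_weighted \<gamma>"
  shows "bdd_above ((\<lambda>x. \<bar>f x * \<gamma> x\<bar>) ` K)"
proof -
  obtain B where "\<And>x. \<bar>f x * \<gamma> x\<bar> \<le> B" using C_b_boundE[OF weighted_C_b[OF assms]] by metis
  then show ?thesis by (intro bdd_aboveI2)
qed

lemma seminorm_family_weighted:
  fixes \<gamma> :: "'a::metric_space \<Rightarrow> real"
  assumes pos: "\<And>\<xi>. \<gamma> \<xi> > 0"
  shows "seminorm_family (C_weighted \<gamma>) (weighted_seminorms \<gamma>)"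
proof
  have add: "x + y \<in> C_weighted \<gamma>" if "x \<in> C_weighted \<gamma>" "y \<in> C_weighted \<gamma>" for x y
    using that C_b_add[of "\<lambda>t. x t * \<gamma> t" "\<lambda>t. y t * \<gamma> t"]
    by (auto simp: C_weighted_def plus_fun_def distrib_right intro: continuous_on_add)
  have scale: "c *\<^sub>R x \<in> C_weighted \<gamma>" if "x \<in> C_weighted \<gamma>" for c x
    using that C_b_cmult[of "\<lambda>t. x t * \<gamma> t" c]
    by (auto simp: C_weighted_def scaleR_fun_def mult.assoc intro: continuous_on_mult_left)
  have zero: "0 \<in> C_weighted \<gamma>"
    using C_bI[of "\<lambda>x. 0" 0] by (simp add: C_weighted_def zero_fun_def)
  show "subspace (C_weighted \<gamma>)" unfolding subspace_def using add scale zero by blast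
  show "weighted_seminorms \<gamma> \<noteq> {}"
    unfolding weighted_seminorms_def
    by (auto intro!: exI[of _ "{undefined}"] exI[of _ "\<lambda>A. 0"] simp: ca_def)
  fix p assume p: "p \<in> weighted_seminorms \<gamma>"
  then obtain K m where Km: "p = weighted_seminorm \<gamma> K m" "compact K" "K \<noteq> {}" "m \<in> ca"
    unfolding weighted_seminorms_def by blast
  show "p (x + y) \<le> p x + p y" if xy: "x \<in> C_weighted \<gamma>" "y \<in> C_weighted \<gamma>" for x y
  proof -
    have "(SUP t\<in>K. \<bar>(x + y) t * \<gamma> t\<bar>) \<le> (SUP t\<in>K. \<bar>x t * \<gamma> t\<bar>) + (SUP t\<in>K. \<bar>y t * \<gamma> t\<bar>)"
    proof (rule cSUP_least[OF Km(3)])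
      fix t assume t: "t \<in> K"
      have "\<bar>(x + y) t * \<gamma> t\<bar> \<le> \<bar>x t * \<gamma> t\<bar> + \<bar>y t * \<gamma> t\<bar>"
        by (simp add: plus_fun_def distrib_right)
      also have "\<dots> \<le> (SUP t\<in>K. \<bar>x t * \<gamma> t\<bar>) + (SUP t\<in>K. \<bar>y t * \<gamma> t\<bar>)"
        by (intro add_mono cSUP_upper t weighted_bdd_above xy)
      finally show "\<bar>(x + y) t * \<gamma> t\<bar> \<le> \<dots>" .
    qed
    moreover have "signed_integral m (\<lambda>t. (x + y) t * \<gamma> t)
        = signed_integral m (\<lambda>t. x t * \<gamma> t) + signed_integral m (\<lambda>t. y t * \<gamma> t)"
      using signed_integral_add[OF Km(4) weighted_C_b[OF xy(1)] weighted_C_b[OF xy(2)]]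
      by (simp add: plus_fun_def distrib_right)
    ultimately show ?thesis unfolding Km(1) weighted_seminorm_def by linarith
  qed
  show "p (c *\<^sub>R x) = \<bar>c\<bar> * p x" if x: "x \<in> C_weighted \<gamma>" for c x
  proof -
    have "(SUP t\<in>K. \<bar>(c *\<^sub>R x) t * \<gamma> t\<bar>) = (SUP t\<in>K. \<bar>c\<bar> * \<bar>x t * \<gamma> t\<bar>)"
      by (simp add: scaleR_fun_def abs_mult mult.assoc)
    also have "\<dots> = \<bar>c\<bar> * (SUP t\<in>K. \<bar>x t * \<gamma> t\<bar>)"
      using continuous_at_Sup_mono[of "\<lambda>s. \<bar>c\<bar> * s" "(\<lambda>t. \<bar>x t * \<gamma> t\<bar>) ` K"] Km(3) weighted_bdd_above[OF x]
      by (simp add: image_image mono_def mult_left_mono continuous_intros)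
    finally have "(SUP t\<in>K. \<bar>(c *\<^sub>R x) t * \<gamma> t\<bar>) = \<bar>c\<bar> * (SUP t\<in>K. \<bar>x t * \<gamma> t\<bar>)" .
    then show ?thesis
      using signed_integral_cmult[of m c "\<lambda>t. x t * \<gamma> t"]
      unfolding Km(1) weighted_seminorm_def
      by (simp add: scaleR_fun_def mult.assoc abs_mult distrib_left)
  qed
next
  fix x assume x: "x \<in> C_weighted \<gamma>" "x \<noteq> 0"
  then obtain t where t: "x t \<noteq> 0" by (auto simp: fun_eq_iff)
  let ?p = "weighted_seminorm \<gamma> {t} (\<lambda>A. 0)"
  have "0 < \<bar>x t * \<gamma> t\<bar>" using t pos[of t] by simp
  moreover have "(SUP s\<in>{t}. \<bar>x s * \<gamma> s\<bar>) = \<bar>x t * \<gamma> t\<bar>" by simp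
  ultimately have "?p x \<noteq> 0" unfolding weighted_seminorm_def by linarith
  moreover have "?p \<in> weighted_seminorms \<gamma>"
    unfolding weighted_seminorms_def
    by (auto intro!: exI[of _ "{t}"] exI[of _ "\<lambda>A. 0"] simp: ca_def)
  ultimately show "\<exists>p\<in>weighted_seminorms \<gamma>. p x \<noteq> 0" by blast
qed

text \<open>Dominated convergence, uniformly over an index set. The family need not be a sequence, but if the
  conclusion failed there would be a sequence of indices \<open>i\<^sub>n \<in> A\<^sub>n\<close> on which it fails. Passing
  to that sequence avoids the supremum over the index set, which may fail to be measurable.\<close>

lemma integral_small_of_pointwise_small:
  fixes M :: "'a::topological_space measure" and A :: "nat \<Rightarrow> 'i set" and g :: "'i \<Rightarrow> 'a \<Rightarrow> real"
  assumes M: "M \<in> ca_plus"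
    and g: "\<And>i. i \<in> A 0 \<Longrightarrow> continuous_on UNIV (g i)"
    and A: "decseq A"
    and bound: "\<And>i x. i \<in> A 0 \<Longrightarrow> \<bar>g i x\<bar> \<le> B"
    and small: "\<And>x e. 0 < e \<Longrightarrow> \<exists>n. \<forall>i\<in>A n. \<bar>g i x\<bar> < e"
    and e: "0 < e"
  shows "\<exists>n. \<forall>i\<in>A n. \<bar>\<integral>x. g i x \<partial>M\<bar> < e"
proof (rule ccontr)
  assume "\<not> ?thesis"
  then have "\<forall>n. \<exists>i\<in>A n. e \<le> \<bar>\<integral>x. g i x \<partial>M\<bar>" by (meson not_less)
  then obtain i where i: "\<And>n. i n \<in> A n" "\<And>n. e \<le> \<bar>\<integral>x. g (i n) x \<partial>M\<bar>" by metis
  have i0: "i n \<in> A 0" for n using i(1)[of n] decseqD[OF A, of 0 n] by auto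
  interpret finite_measure M using M by (simp add: ca_plus_def)
  have "(\<lambda>n. \<integral>x. g (i n) x \<partial>M) \<longlonglongrightarrow> (\<integral>x. 0 \<partial>M)"
  proof (rule integral_dominated_convergence[where w="\<lambda>_. B"])
    show "AE x in M. (\<lambda>n. g (i n) x) \<longlonglongrightarrow> 0"
    proof (rule AE_I2, rule LIMSEQ_I)
      fix x and r :: real assume "0 < r"
      then obtain N where N: "\<forall>i\<in>A N. \<bar>g i x\<bar> < r" using small by blast
      have "norm (g (i n) x - 0) < r" if "N \<le> n" for n
        using N i(1)[of n] decseqD[OF A that] by auto
      then show "\<exists>N. \<forall>n\<ge>N. norm (g (i n) x - 0) < r"
        by blast
    qed
  qed (use i0 g bound in \<open>auto intro: measurable_ca_plus[OF M]\<close>)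
  then have "eventually (\<lambda>n. \<bar>\<integral>x. g (i n) x \<partial>M\<bar> < e) sequentially"
    using e by (auto dest!: tendstoD[where e=e] simp: dist_real_def)
  then show False using i(2) by (auto simp: eventually_sequentially not_less[symmetric])
qed

text \<open>The criterion from which all convergence statements in the weighted topology are derived. The sets
  \<open>A\<^sub>n\<close> play the role of a countable filter base.\<close>

lemma weighted_seminorm_small:
  fixes \<gamma> :: "'a::metric_space \<Rightarrow> real" and A :: "nat \<Rightarrow> 'i set"
  assumes h: "\<And>i. i \<in> A 0 \<Longrightarrow> h i \<in> C_weighted \<gamma>"
    and A: "decseq A"
    and bound: "\<And>i x. i \<in> A 0 \<Longrightarrow> \<bar>h i x * \<gamma> x\<bar> \<le> B"
    and small: "\<And>K e. compact K \<Longrightarrow> 0 < e \<Longrightarrow> \<exists>n. \<forall>i\<in>A n. \<forall>x\<in>K. \<bar>h i x * \<gamma> x\<bar> < e"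
    and p: "p \<in> weighted_seminorms \<gamma>" and e: "0 < e"
  shows "\<exists>n. \<forall>i\<in>A n. p (h i) < e"
proof -
  obtain K m where Km: "p = weighted_seminorm \<gamma> K m" "compact K" "K \<noteq> {}" "m \<in> ca"
    using p unfolding weighted_seminorms_def by blast
  let ?M = "positive_part m" and ?N = "positive_part (\<lambda>A. - m A)"
  obtain n1 where n1: "\<And>i x. i \<in> A n1 \<Longrightarrow> x \<in> K \<Longrightarrow> \<bar>h i x * \<gamma> x\<bar> < e/3"
    using small[OF Km(2), of "e/3"] e by auto
  have int: "\<exists>n. \<forall>i\<in>A n. \<bar>\<integral>x. h i x * \<gamma> x \<partial>M\<bar> < e/3" if M: "M \<in> ca_plus" for M
  proof (rule integral_small_of_pointwise_small[OF M _ A bound])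
    show "\<exists>n. \<forall>i\<in>A n. \<bar>h i x * \<gamma> x\<bar> < d" if "0 < d" for x d
      using small[of "{x}" d] that by auto
    show "continuous_on UNIV (\<lambda>x. h i x * \<gamma> x)" if "i \<in> A 0" for i
      using h[OF that] by (simp add: C_weighted_def C_b_def)
  qed (use e in auto)
  obtain n2 where n2: "\<And>i. i \<in> A n2 \<Longrightarrow> \<bar>\<integral>x. h i x * \<gamma> x \<partial>?M\<bar> < e/3"
    using int[of ?M] positive_part_in_ca_plus Km(4) by blast
  obtain n3 where n3: "\<And>i. i \<in> A n3 \<Longrightarrow> \<bar>\<integral>x. h i x * \<gamma> x \<partial>?N\<bar> < e/3"
    using int[of ?N] positive_part_in_ca_plus uminus_in_ca Km(4) by blast
  let ?n = "max n1 (max n2 n3)"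
  have "p (h i) < e" if "i \<in> A ?n" for i
  proof -
    have i: "i \<in> A n1" "i \<in> A n2" "i \<in> A n3"
      using that decseqD[OF A, of n1 ?n] decseqD[OF A, of n2 ?n] decseqD[OF A, of n3 ?n]
      by (auto simp: le_max_iff_disj)
    have "(SUP x\<in>K. \<bar>h i x * \<gamma> x\<bar>) \<le> e/3" by (intro cSUP_least Km) (use n1 i in force)
    then show ?thesis using n2[OF i(2)] n3[OF i(3)]
      unfolding Km(1) weighted_seminorm_def signed_integral_def by linarith
  qed
  then show ?thesis by blast
qed

section \<open>Uniform boundedness\<close>

text \<open>Of two numbers differing by \<open>d\<close>, one has absolute value at least \<open>\<bar>d\<bar> / 2\<close>. Applied to the \<open>n\<close>-th
  partial sum with and without its last term, this decides recursively whether the term is kept.\<close>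

lemma exists_selection:
  fixes a :: "nat \<Rightarrow> nat \<Rightarrow> real" and b :: "nat \<Rightarrow> real"
  obtains c where "\<And>n. c n \<in> {0, b n}"
    "\<And>n. \<bar>b n * a n n\<bar> / 2 \<le> \<bar>(\<Sum>j<n. c j * a n j) + c n * a n n\<bar>"
proof -
  have "\<exists>c. \<forall>n. c n \<in> {0, b n} \<and>
      \<bar>b n * a n n\<bar> / 2 \<le> \<bar>(\<Sum>j<n. c j * a n j) + c n * a n n\<bar>"
  proof (rule dependent_wellorder_choice)
    fix n :: nat and c :: "nat \<Rightarrow> real"
    let ?s = "\<Sum>j<n. c j * a n j"
    have "\<bar>b n * a n n\<bar> / 2 \<le> \<bar>?s + 0 * a n n\<bar> \<or> \<bar>b n * a n n\<bar> / 2 \<le> \<bar>?s + b n * a n n\<bar>"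
      by linarith
    then show "\<exists>r. r \<in> {0, b n} \<and> \<bar>b n * a n n\<bar> / 2 \<le> \<bar>?s + r * a n n\<bar>" by blast
  qed simp
  then show thesis using that by blast
qed

lemma discrete_measure:
  fixes c :: "nat \<Rightarrow> real" and x :: "nat \<Rightarrow> 'a::topological_space"
  assumes c: "\<And>n. 0 \<le> c n" "summable c"
  obtains M where "M \<in> ca_plus"
    "\<And>g. g \<in> C_b \<Longrightarrow> (\<lambda>n. c n * g (x n)) sums (\<integral>y. g y \<partial>M)"
proof -
  define N where "N = density (count_space UNIV) (\<lambda>n. ennreal (c n))"
  have x: "x \<in> measurable N borel" by (simp add: N_def)
  define M where "M = distr N borel x"
  have "emeasure N UNIV = (\<Sum>n. ennreal (c n))"
    unfolding N_def by (simp add: emeasure_density nn_integral_count_space_nat)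
  also have "\<dots> = ennreal (suminf c)" using c by (intro suminf_ennreal2)
  finally have "finite_measure N" by (intro finite_measureI) (simp add: N_def)
  then have "finite_measure M" unfolding M_def by (rule finite_measure.finite_measure_distr[OF _ x])
  then have M: "M \<in> ca_plus" by (simp add: ca_plus_def M_def)
  have "(\<lambda>n. c n * g (x n)) sums (\<integral>y. g y \<partial>M)" if g: "g \<in> C_b" for g
  proof -
    have gb: "g \<in> borel_measurable borel"
      using g by (intro borel_measurable_continuous_onI) (simp add: C_b_def)
    have "integrable M g" by (rule integrable_C_b[OF M g])
    then have "integrable N (\<lambda>n. g (x n))"
      unfolding M_def by (simp add: integrable_distr_eq[OF x gb])
    then have "integrable (count_space UNIV) (\<lambda>n. c n * g (x n))"
      unfolding N_def using c(1) by (subst (asm) integrable_density) auto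
    then have "(\<lambda>n. c n * g (x n)) sums (\<integral>n. c n * g (x n) \<partial>count_space UNIV)"
      by (rule sums_integral_count_space_nat)
    moreover have "(\<integral>y. g y \<partial>M) = (\<integral>n. c n * g (x n) \<partial>count_space UNIV)"
      unfolding M_def integral_distr[OF x gb] unfolding N_def using c(1) by (subst integral_density) auto
    ultimately show ?thesis by simp
  qed
  with M show thesis by (rule that)
qed

text \<open>This is the gliding hump argument in the form due to Sokal. Pass to a subsequence \<open>g\<^sub>k\<close> with
  nearly maximal values larger than \<open>10\<^sup>k\<close> at points \<open>x\<^sub>k\<close>, and choose weights \<open>c\<^sub>k \<in> {0, 9\<^sup>-\<^sup>k}\<close> so that the
  terms up to \<open>k\<close> of \<open>\<Sum>\<^sub>j c\<^sub>j g\<^sub>k(x\<^sub>j)\<close> do not cancel. The tail cannot compensate, because the weights decay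
  geometrically and \<open>g\<^sub>k\<close> is controlled by its value at \<open>x\<^sub>k\<close>. So the integrals of \<open>g\<^sub>k\<close> against
  \<open>\<Sum>\<^sub>j c\<^sub>j \<delta>\<^bsub>x\<^sub>j\<^esub>\<close> grow at least like \<open>(10/9)\<^sup>k\<close>.\<close>

lemma uniform_boundedness_C_b:
  fixes g :: "nat \<Rightarrow> 'a::topological_space \<Rightarrow> real"
  assumes g: "\<And>n. g n \<in> C_b"
    and bounded: "\<And>M. M \<in> ca_plus \<Longrightarrow> Bseq (\<lambda>n. \<integral>x. g n x \<partial>M)"
  shows "\<exists>B. \<forall>n x. \<bar>g n x\<bar> \<le> B"
proof (rule ccontr)
  assume unb: "\<nexists>B. \<forall>n x. \<bar>g n x\<bar> \<le> B"
  have "\<exists>n x. 10 ^ k < \<bar>g n x\<bar> \<and> (\<forall>y. \<bar>g n y\<bar> \<le> 2 * \<bar>g n x\<bar>)" for k :: nat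
  proof -
    obtain n x0 where n: "2 * 10 ^ k < \<bar>g n x0\<bar>"
      using unb not_le by blast
    obtain B where B: "\<And>x. \<bar>g n x\<bar> \<le> B" using C_b_boundE[OF g] by metis
    let ?L = "SUP x. \<bar>g n x\<bar>"
    have bdd: "bdd_above (range (\<lambda>x. \<bar>g n x\<bar>))" using B by (intro bdd_aboveI2)
    have L: "\<bar>g n y\<bar> \<le> ?L" for y using bdd by (intro cSUP_upper) auto
    have "(0::real) < 10 ^ k" by simp
    then have "0 < ?L" using n L[of x0] by linarith
    then have "?L / 2 < ?L" by simp
    then obtain x where x: "?L / 2 < \<bar>g n x\<bar>" using less_cSUP_iff[OF UNIV_not_empty bdd] by blast
    have "\<bar>g n y\<bar> \<le> 2 * \<bar>g n x\<bar>" for y using L[of y] x by linarith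
    moreover have "10 ^ k < \<bar>g n x\<bar>" using n L[of x0] x by linarith
    ultimately show ?thesis by blast
  qed
  then obtain n x where nx: "\<And>k. 10 ^ k < \<bar>g (n k) (x k)\<bar>"
    "\<And>k y. \<bar>g (n k) y\<bar> \<le> 2 * \<bar>g (n k) (x k)\<bar>"
    by metis
  define b :: "nat \<Rightarrow> real" where "b k = (1/9) ^ k" for k
  obtain c where c: "\<And>k. c k \<in> {0, b k}" and half: "\<And>k. \<bar>b k * g (n k) (x k)\<bar> / 2
      \<le> \<bar>(\<Sum>j<k. c j * g (n k) (x j)) + c k * g (n k) (x k)\<bar>"
    using exists_selection[of b "\<lambda>k j. g (n k) (x j)"] by blast
  have b0: "0 < b k" for k by (simp add: b_def)
  have cb: "0 \<le> c k" "c k \<le> b k" for k using c[of k] b0[of k] by auto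
  have sb: "summable b" unfolding b_def by (intro summable_geometric) simp
  have sc: "summable c" using cb by (intro summable_comparison_test'[OF sb, of 0]) auto
  obtain M where M: "M \<in> ca_plus"
    "\<And>g. g \<in> C_b \<Longrightarrow> (\<lambda>n. c n * g (x n)) sums (\<integral>y. g y \<partial>M)"
    using discrete_measure[OF cb(1) sc, of x] by blast
  have lower: "(10/9) ^ k / 4 \<le> \<bar>\<integral>y. g (n k) y \<partial>M\<bar>" for k
  proof -
    let ?G = "\<bar>g (n k) (x k)\<bar>" and ?t = "\<lambda>j. c (j + Suc k) * g (n k) (x (j + Suc k))"
    note s = M(2)[OF g[of "n k"]]
    have "(\<integral>y. g (n k) y \<partial>M) = (\<Sum>j. ?t j) + (\<Sum>j<Suc k. c j * g (n k) (x j))"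
      using suminf_split_initial_segment[OF sums_summable[OF s], of "Suc k"] sums_unique[OF s] by simp
    moreover have "\<bar>\<Sum>j. ?t j\<bar> \<le> b k * ?G / 4"
    proof -
      have "norm (?t j) \<le> b (j + Suc k) * (2 * ?G)" for j
        using cb[of "j + Suc k"] nx(2)[of k "x (j + Suc k)"]
        by (auto simp: abs_mult intro!: mult_mono)
      moreover have "(\<lambda>j. b (j + Suc k) * (2 * ?G)) sums (b k * ?G / 4)"
      proof -
        have "(\<lambda>j. (1/9) ^ j :: real) sums (1 / (1 - 1/9))" by (intro geometric_sums) simp
        from sums_mult2[OF this, of "(1/9) ^ Suc k * (2 * ?G)"] show ?thesis
          by (simp add: b_def power_add mult_ac)
      qed
      ultimately show ?thesis
        using norm_suminf_le[of ?t] by (metis (no_types, lifting) real_norm_def sums_summable sums_unique)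
    qed
    moreover have "\<bar>b k * g (n k) (x k)\<bar> = b k * ?G" using b0[of k] by (simp add: abs_mult)
    moreover have "(10/9) ^ k \<le> b k * ?G"
    proof -
      have "b k * 10 ^ k \<le> b k * ?G" using nx(1)[of k] b0[of k] by (intro mult_left_mono) auto
      moreover have "b k * 10 ^ k = (10/9) ^ k" by (simp add: b_def power_divide)
      ultimately show ?thesis by simp
    qed
    ultimately show ?thesis using half[of k] unfolding sum.lessThan_Suc by linarith
  qed
  obtain C where C: "\<And>m. \<bar>\<integral>y. g m y \<partial>M\<bar> \<le> C" using bounded[OF M(1)] unfolding Bseq_def by auto
  then have "(10/9) ^ k \<le> 4 * C" for k :: nat
    using lower[of k] C[of "n k"] by linarith
  moreover obtain k :: nat where "4 * C < (10/9) ^ k" using real_arch_pow[of "10/9" "4 * C"] by auto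
  ultimately show False by (meson not_le)
qed

text \<open>Together with \<open>weighted_seminorm_small\<close> this characterises sequential convergence: it is bounded
  convergence that is uniform on compact sets.\<close>

lemma limitin_weighted_bounded:
  fixes \<gamma> :: "'a::metric_space \<Rightarrow> real"
  assumes pos: "\<And>\<xi>. \<gamma> \<xi> > 0"
    and zs: "\<And>n. zs n \<in> C_weighted \<gamma>" and lim: "limitin (tau_weighted \<gamma>) zs z sequentially"
  shows "\<exists>B. \<forall>n x. \<bar>(zs n - z) x * \<gamma> x\<bar> \<le> B"
    and "compact K \<Longrightarrow> 0 < e \<Longrightarrow> \<exists>N. \<forall>n\<ge>N. \<forall>x\<in>K. \<bar>(zs n - z) x * \<gamma> x\<bar> < e"
proof -
  interpret seminorm_family "C_weighted \<gamma>" "weighted_seminorms \<gamma>"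
    by (rule seminorm_family_weighted[OF pos])
  have L: "z \<in> C_weighted \<gamma>"
    "\<And>p e. p \<in> weighted_seminorms \<gamma> \<Longrightarrow> 0 < e \<Longrightarrow> eventually (\<lambda>n. p (zs n - z) < e) sequentially"
    using lim unfolding tau_weighted_eq limitin_iff by auto
  have d: "zs n - z \<in> C_weighted \<gamma>" for n using zs L(1) by (rule diff)
  have ca0: "(\<lambda>A. 0) \<in> ca" by (simp add: ca_def)
  show "\<exists>B. \<forall>n x. \<bar>(zs n - z) x * \<gamma> x\<bar> \<le> B"
  proof (rule uniform_boundedness_C_b)
    show "(\<lambda>x. (zs n - z) x * \<gamma> x) \<in> C_b" for n by (rule weighted_C_b[OF d])
    fix M :: "'a measure" assume M: "M \<in> ca_plus"
    let ?p = "weighted_seminorm \<gamma> {undefined} (measure M)"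
    have "?p \<in> weighted_seminorms \<gamma>"
      unfolding weighted_seminorms_def using measure_in_ca[OF M]
      by (intro CollectI exI[of _ "{undefined}"] exI[of _ "measure M"]) simp
    have le: "\<bar>\<integral>x. (zs n - z) x * \<gamma> x \<partial>M\<bar> \<le> ?p (zs n - z)" for n
      unfolding weighted_seminorm_def signed_integral_measure[OF M] by simp
    have "(\<lambda>n. \<integral>x. (zs n - z) x * \<gamma> x \<partial>M) \<longlonglongrightarrow> 0"
    proof (rule tendstoI)
      fix e :: real assume "0 < e"
      from L(2)[OF \<open>?p \<in> _\<close> this]
      show "eventually (\<lambda>n. dist (\<integral>x. (zs n - z) x * \<gamma> x \<partial>M) 0 < e) sequentially"
      proof eventually_elim
        case (elim n)
        then show ?case using le[of n] by (simp add: dist_real_def)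
      qed
    qed
    then show "Bseq (\<lambda>n. \<integral>x. (zs n - z) x * \<gamma> x \<partial>M)"
      by (intro convergent_imp_Bseq convergentI)
  qed
  show "\<exists>N. \<forall>n\<ge>N. \<forall>x\<in>K. \<bar>(zs n - z) x * \<gamma> x\<bar> < e" if K: "compact K" and e: "0 < e"
  proof (cases "K = {}")
    case False
    let ?p = "weighted_seminorm \<gamma> K (\<lambda>A. 0)"
    have "?p \<in> weighted_seminorms \<gamma>" unfolding weighted_seminorms_def using K False ca0 by blast
    from L(2)[OF this e] obtain N where N: "\<And>n. N \<le> n \<Longrightarrow> ?p (zs n - z) < e"
      by (auto simp: eventually_sequentially)
    have "\<bar>(zs n - z) x * \<gamma> x\<bar> < e" if "N \<le> n" "x \<in> K" for n x
    proof -
      have "\<bar>(zs n - z) x * \<gamma> x\<bar> \<le> (SUP x\<in>K. \<bar>(zs n - z) x * \<gamma> x\<bar>)"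
        by (rule cSUP_upper[OF that(2) weighted_bdd_above[OF d]])
      then show ?thesis using N[OF that(1)] unfolding weighted_seminorm_def by linarith
    qed
    then show ?thesis by blast
  qed simp
qed

section \<open>Semigroups of transition kernels\<close>

text \<open>Stronger than uniform continuity on \<open>K\<close>: the second point may lie outside \<open>K\<close>.\<close>

lemma compact_uniform_continuity_nearby:
  fixes g :: "'a::metric_space \<Rightarrow> real"
  assumes K: "compact K" and g: "continuous_on UNIV g" and e: "0 < e"
  shows "\<exists>r>0. \<forall>x\<in>K. \<forall>y. dist x y < r \<longrightarrow> \<bar>g y - g x\<bar> < e"
proof (rule ccontr)
  assume "\<not> ?thesis"
  then have "\<exists>x\<in>K. \<exists>y. dist x y < inverse (real (Suc n)) \<and> e \<le> \<bar>g y - g x\<bar>" for n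
    by (metis inverse_positive_iff_positive not_le of_nat_0_less_iff zero_less_Suc)
  then obtain x y where xy: "\<And>n. x n \<in> K" "\<And>n. dist (x n) (y n) < inverse (real (Suc n))"
    "\<And>n. e \<le> \<bar>g (y n) - g (x n)\<bar>" by metis
  obtain l s where l: "l \<in> K" "strict_mono s" "(x \<circ> s) \<longlonglongrightarrow> l"
    using K xy(1) unfolding compact_def by metis
  have "(\<lambda>n. dist (x n) (y n)) \<longlonglongrightarrow> 0"
    using xy(2) by (intro tendsto_sandwich[OF _ _ tendsto_const LIMSEQ_inverse_real_of_nat])
      (auto intro!: always_eventually less_imp_le)
  then have d: "(\<lambda>n. dist ((x \<circ> s) n) ((y \<circ> s) n)) \<longlonglongrightarrow> 0"
    using LIMSEQ_subseq_LIMSEQ[OF _ l(2)] by (fastforce simp: o_def)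
  have "(\<lambda>n. dist ((x \<circ> s) n) ((y \<circ> s) n) + dist ((x \<circ> s) n) l) \<longlonglongrightarrow> 0 + 0"
    by (intro tendsto_add d tendsto_dist_iff[THEN iffD1, OF l(3)])
  then have sum0: "(\<lambda>n. dist ((x \<circ> s) n) ((y \<circ> s) n) + dist ((x \<circ> s) n) l) \<longlonglongrightarrow> 0" by simp
  have "(\<lambda>n. dist ((y \<circ> s) n) l) \<longlonglongrightarrow> 0"
    by (rule Lim_null_comparison[OF _ sum0]) (simp add: dist_triangle3)
  then have "(y \<circ> s) \<longlonglongrightarrow> l" by (rule tendsto_dist_iff[THEN iffD2])
  have at: "isCont g l" using g by (simp add: continuous_on_eq_continuous_at)
  have "(\<lambda>n. g ((y \<circ> s) n) - g ((x \<circ> s) n)) \<longlonglongrightarrow> g l - g l"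
    by (intro tendsto_diff isCont_tendsto_compose[OF at] l(3) \<open>(y \<circ> s) \<longlonglongrightarrow> l\<close>)
  then have "eventually (\<lambda>n. \<bar>g ((y \<circ> s) n) - g ((x \<circ> s) n)\<bar> < e) sequentially"
    using e by (auto dest!: tendstoD[where e=e] simp: dist_real_def)
  then show False using xy(3) by (auto simp: eventually_sequentially not_less[symmetric])
qed

locale kernel_semigroup =
  fixes \<nu> :: "real \<Rightarrow> 'a::metric_space \<Rightarrow> 'a measure"
  assumes ca_plus: "\<And>t \<xi>. t \<ge> 0 \<Longrightarrow> \<nu> t \<xi> \<in> ca_plus"
    and A1: "cond_A1 \<nu>" and A2: "cond_A2 \<nu>" and A3: "cond_A3 \<nu>" and A4: "cond_A4 \<nu>" and A5: "cond_A5 \<nu>"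
begin

abbreviation S :: "real \<Rightarrow> ('a \<Rightarrow> real) \<Rightarrow> 'a \<Rightarrow> real" where
  "S \<equiv> transition_operator \<nu>"

lemma sets_borel: "t \<ge> 0 \<Longrightarrow> sets (\<nu> t \<xi>) = sets borel"
  using ca_plus[of t \<xi>] by (simp add: ca_plus_def)

lemma finite_measure: "t \<ge> 0 \<Longrightarrow> finite_measure (\<nu> t \<xi>)"
  using ca_plus[of t \<xi>] by (simp add: ca_plus_def)

lemma mass_bounded: "\<exists>C\<ge>1. \<forall>t\<ge>0. \<forall>\<xi>. measure (\<nu> t \<xi>) UNIV \<le> C"
proof -
  obtain C where C: "\<And>t \<xi>. t \<ge> 0 \<Longrightarrow> tv_norm (measure (\<nu> t \<xi>)) \<le> ennreal C"
    using A1 unfolding cond_A1_def by blast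
  have "measure (\<nu> t \<xi>) UNIV \<le> max C 1" if t: "t \<ge> 0" for t \<xi>
  proof -
    have "(\<Sum>A\<in>{UNIV}. ennreal \<bar>measure (\<nu> t \<xi>) A\<bar>) \<le> tv_norm (measure (\<nu> t \<xi>))"
      unfolding tv_norm_def by (rule SUP_upper) (simp add: disjoint_def)
    also have "\<dots> \<le> ennreal (max C 1)" using C[OF t, of \<xi>] by (rule order_trans) (simp add: ennreal_leI)
    finally show ?thesis by simp
  qed
  then show ?thesis by (intro exI[of _ "max C 1"]) auto
qed

text \<open>A bound that is at least \<open>1\<close>, so that it can be divided by.\<close>

definition mass_bound :: real where
  "mass_bound = (SOME C. C \<ge> 1 \<and> (\<forall>t\<ge>0. \<forall>\<xi>. measure (\<nu> t \<xi>) UNIV \<le> C))"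

lemma mass_bound: "mass_bound \<ge> 1" "t \<ge> 0 \<Longrightarrow> measure (\<nu> t \<xi>) UNIV \<le> mass_bound"
  using someI_ex[OF mass_bounded] unfolding mass_bound_def by auto

lemma integrable: "t \<ge> 0 \<Longrightarrow> g \<in> C_b \<Longrightarrow> integrable (\<nu> t \<xi>) g"
  by (rule integrable_C_b[OF ca_plus])

text \<open>The basic estimate: the set \<open>A\<close> where \<open>g\<close> is small contributes little whatever its mass, and its
  complement contributes little if its mass is small. It is applied with \<open>A\<close> compact, a ball, or the whole space.\<close>

lemma S_split_bound:
  assumes t: "t \<ge> 0" and g: "g \<in> C_b" and A: "A \<in> sets borel"
    and a: "0 \<le> a" "\<And>x. x \<in> A \<Longrightarrow> \<bar>g x\<bar> \<le> a" and b: "0 \<le> b" "\<And>x. \<bar>g x\<bar> \<le> b"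
  shows "\<bar>S t g \<xi>\<bar> \<le> a * mass_bound + b * measure (\<nu> t \<xi>) (- A)"
proof -
  interpret finite_measure "\<nu> t \<xi>" by (rule finite_measure[OF t])
  have sets: "sets (\<nu> t \<xi>) = sets borel" by (rule sets_borel[OF t])
  have space: "space (\<nu> t \<xi>) = UNIV" by (rule space_ca_plus[OF ca_plus[OF t]])
  have cA: "- A \<in> sets (\<nu> t \<xi>)" unfolding sets using A by (rule borel_comp)
  have ind: "integrable (\<nu> t \<xi>) (indicator (- A) :: 'a \<Rightarrow> real)"
    using cA by (intro integrable_real_indicator) (auto simp: emeasure_eq_measure)
  have "\<bar>S t g \<xi>\<bar> \<le> (\<integral>x. \<bar>g x\<bar> \<partial>\<nu> t \<xi>)"
    unfolding transition_operator_def by (rule integral_abs_bound)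
  also have "\<dots> \<le> (\<integral>x. a + b * indicator (- A) x \<partial>\<nu> t \<xi>)"
  proof (rule integral_mono)
    show "integrable (\<nu> t \<xi>) (\<lambda>x. a + b * indicator (- A) x)"
      by (intro Bochner_Integration.integrable_add integrable_mult_right ind) simp
    show "\<bar>g x\<bar> \<le> a + b * indicator (- A) x" for x
      using a b by (cases "x \<in> A") (auto intro: add_increasing)
  qed (use integrable[OF t g] in simp)
  also have "\<dots> = a * measure (\<nu> t \<xi>) UNIV + b * measure (\<nu> t \<xi>) (- A)"
    using ind space by (subst Bochner_Integration.integral_add) (simp_all add: mult.commute)
  also have "\<dots> \<le> a * mass_bound + b * measure (\<nu> t \<xi>) (- A)"
    using mass_bound(2)[OF t] a(1) by (intro add_right_mono mult_left_mono)
  finally show ?thesis .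
qed

lemma S_bound:
  assumes t: "t \<ge> 0" and g: "g \<in> C_b" and b: "\<And>x. \<bar>g x\<bar> \<le> b"
  shows "\<bar>S t g \<xi>\<bar> \<le> mass_bound * b"
proof -
  have "0 \<le> b" using b[of undefined] abs_ge_zero[of "g undefined"] by linarith
  with S_split_bound[OF t g, of UNIV b b \<xi>] b show ?thesis by (simp add: mult.commute)
qed

lemma S_C_b:
  assumes t: "t \<ge> 0" and g: "g \<in> C_b"
  shows "S t g \<in> C_b"
proof -
  obtain b where b: "\<And>x. \<bar>g x\<bar> \<le> b" using C_b_boundE[OF g] by metis
  have "continuous_on UNIV (S t g)"
    using A2 t g unfolding cond_A2_def transition_operator_def by blast
  then show ?thesis by (rule C_bI) (rule S_bound[OF t g b])
qed

lemma S_diff: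
  "t \<ge> 0 \<Longrightarrow> f \<in> C_b \<Longrightarrow> g \<in> C_b \<Longrightarrow> S t (\<lambda>x. f x - g x) \<xi> = S t f \<xi> - S t g \<xi>"
  unfolding transition_operator_def by (intro Bochner_Integration.integral_diff integrable)

text \<open>The order of composition is opposite to the one in (A3); exchanging the two times repairs this.\<close>

lemma S_add: "t \<ge> 0 \<Longrightarrow> s \<ge> 0 \<Longrightarrow> g \<in> C_b \<Longrightarrow> S (t + s) g = S t (S s g)"
  using A3 unfolding cond_A3_def transition_operator_def by (subst add.commute) (auto simp: fun_eq_iff)

lemma S_0:
  assumes g: "g \<in> C_b"
  shows "S 0 g \<xi> = g \<xi>"
proof -
  interpret finite_measure "\<nu> 0 \<xi>" by (rule finite_measure) simp
  have sets: "sets (\<nu> 0 \<xi>) = sets borel" by (rule sets_borel) simp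
  have m: "measure (\<nu> 0 \<xi>) A = indicator A \<xi>" if "A \<in> sets borel" for A
    using A1 that unfolding cond_A1_def by blast
  have "emeasure (\<nu> 0 \<xi>) (- {\<xi>}) = 0" using m[of "- {\<xi>}"] by (simp add: emeasure_eq_measure)
  then have "AE x in \<nu> 0 \<xi>. g x = g \<xi>"
    by (intro AE_I'[of "- {\<xi>}"]) (auto simp: null_sets_def sets)
  then have "S 0 g \<xi> = (\<integral>x. g \<xi> \<partial>\<nu> 0 \<xi>)"
    unfolding transition_operator_def
    by (intro integral_cong_AE measurable_ca_plus[OF ca_plus]) (use g in \<open>auto simp: C_b_def\<close>)
  also have "\<dots> = g \<xi>" using m[of UNIV] space_ca_plus[OF ca_plus[of 0 \<xi>]] by simp
  finally show ?thesis .
qed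

lemma tight:
  assumes "compact K" "0 < e" "0 \<le> R"
  obtains K0 where "compact K0" "\<And>t \<xi>. t \<in> {0..R} \<Longrightarrow> \<xi> \<in> K \<Longrightarrow> measure (\<nu> t \<xi>) (- K0) < e"
proof -
  have "0 < R + 1" using assms by simp
  then obtain K0 where K0: "compact K0"
    "\<And>t \<xi>. t \<in> {0..R+1} \<Longrightarrow> \<xi> \<in> K \<Longrightarrow> measure (\<nu> t \<xi>) UNIV - e < measure (\<nu> t \<xi>) K0"
    using A4 assms unfolding cond_A4_def by meson
  have "measure (\<nu> t \<xi>) (- K0) < e" if "t \<in> {0..R}" "\<xi> \<in> K" for t \<xi>
  proof -
    have t: "0 \<le> t" using that by simp
    interpret finite_measure "\<nu> t \<xi>" by (rule finite_measure[OF t])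
    have "K0 \<in> sets (\<nu> t \<xi>)" using K0(1) sets_borel[OF t] by (simp add: borel_compact)
    then have "measure (\<nu> t \<xi>) (- K0) = measure (\<nu> t \<xi>) UNIV - measure (\<nu> t \<xi>) K0"
      using finite_measure_compl[of K0] space_ca_plus[OF ca_plus[OF t]] by (simp add: Compl_eq_Diff_UNIV)
    then show ?thesis using K0(2)[of t \<xi>] that by simp
  qed
  with K0(1) show thesis by (rule that)
qed

text \<open>The compact set and the threshold depend on the bound \<open>b\<close>, but not on \<open>g\<close>. This is what makes the
  operators \<open>S\<^sub>t\<close> equicontinuous along bounded sequences.\<close>

lemma S_uniformly_small:
  assumes K: "compact K" and R: "0 \<le> R" and e: "0 < e" and b: "0 \<le> b"
  obtains K0 d where "compact K0" "0 < d" "\<And>g t \<xi>. g \<in> C_b \<Longrightarrow> (\<And>x. \<bar>g x\<bar> \<le> b) \<Longrightarrow>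
    (\<And>x. x \<in> K0 \<Longrightarrow> \<bar>g x\<bar> \<le> d) \<Longrightarrow> t \<in> {0..R} \<Longrightarrow> \<xi> \<in> K \<Longrightarrow> \<bar>S t g \<xi>\<bar> < e"
proof -
  have "0 < e / (2 * (b + 1))" using e b by simp
  then obtain K0 where K0: "compact K0"
    "\<And>t \<xi>. t \<in> {0..R} \<Longrightarrow> \<xi> \<in> K \<Longrightarrow> measure (\<nu> t \<xi>) (- K0) < e / (2 * (b + 1))"
    using tight[OF K _ R] by metis
  define d where "d = e / (2 * mass_bound)"
  have d: "0 < d" using e mass_bound(1) by (simp add: d_def)
  have "\<bar>S t g \<xi>\<bar> < e"
    if g: "g \<in> C_b" "\<And>x. \<bar>g x\<bar> \<le> b" "\<And>x. x \<in> K0 \<Longrightarrow> \<bar>g x\<bar> \<le> d" "t \<in> {0..R}" "\<xi> \<in> K" for g t \<xi>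
  proof -
    have "b * measure (\<nu> t \<xi>) (- K0) \<le> b * (e / (2 * (b + 1)))"
      using K0(2)[OF g(4,5)] b by (intro mult_left_mono) auto
    also have "\<dots> < e / 2" using b e by (simp add: field_simps)
    finally have "b * measure (\<nu> t \<xi>) (- K0) < e / 2" .
    moreover have "\<bar>S t g \<xi>\<bar> \<le> d * mass_bound + b * measure (\<nu> t \<xi>) (- K0)"
      using g K0(1) d b by (intro S_split_bound) (auto simp: borel_compact)
    moreover have "d * mass_bound = e / 2" using mass_bound(1) by (simp add: d_def)
    ultimately show ?thesis by linarith
  qed
  with K0(1) d show thesis by (rule that)
qed

lemma mass_near_point:
  assumes K: "compact K" and r: "0 < r" and e: "0 < e"
  shows "eventually (\<lambda>t. \<forall>\<xi>\<in>K. \<bar>measure (\<nu> t \<xi>) (ball \<xi> r) - 1\<bar> < e) (at_right 0)"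
proof (cases "K = {}")
  case False
  let ?d = "\<lambda>t \<xi>. \<bar>measure (\<nu> t \<xi>) (ball \<xi> r) - 1\<bar>"
  have "((\<lambda>t. SUP \<xi>\<in>K. ?d t \<xi>) \<longlongrightarrow> 0) (at_right 0)"
    using A5 K r False unfolding cond_A5_def by blast
  then have "eventually (\<lambda>t. (SUP \<xi>\<in>K. ?d t \<xi>) < e) (at_right 0)"
    using e by (rule order_tendstoD(2))
  moreover have "eventually (\<lambda>t. 0 < t) (at_right (0::real))" by (rule eventually_at_right_less)
  ultimately show ?thesis
  proof eventually_elim
    case (elim t)
    then have t: "0 \<le> t" by simp
    interpret finite_measure "\<nu> t \<xi>" for \<xi> by (rule finite_measure[OF t])
    have "?d t \<xi> \<le> mass_bound + 1" for \<xi>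
    proof -
      have "measure (\<nu> t \<xi>) (ball \<xi> r) \<le> measure (\<nu> t \<xi>) UNIV"
        by (rule finite_measure_mono) (use sets_borel[OF t] in auto)
      then show ?thesis
        using mass_bound(2)[OF t, of \<xi>] measure_nonneg[of "\<nu> t \<xi>" "ball \<xi> r"] by linarith
    qed
    then have "bdd_above (?d t ` K)" by (intro bdd_aboveI2)
    then have "?d t \<xi> \<le> (SUP \<xi>\<in>K. ?d t \<xi>)" if "\<xi> \<in> K" for \<xi> using that by (rule cSUP_upper2) simp
    then show ?case using elim(1) by (meson le_less_trans)
  qed
qed simp

text \<open>Condition (A5) controls the mass of balls only, and not the mass outside them. But by (A4) all but
  a small part of the mass lies in a compact set, hence in a ball of some fixed radius \<open>D\<close> around every
  \<open>\<xi> \<in> K\<close>, and (A5) for this large ball bounds the total mass by nearly \<open>1\<close>. Comparing with a small ball of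
  radius \<open>r\<close> leaves little mass outside of it.\<close>

lemma S_tendsto_uniformly_on_compact:
  assumes K: "compact K" and g: "g \<in> C_b" and e: "0 < e"
  shows "eventually (\<lambda>t. \<forall>\<xi>\<in>K. \<bar>S t g \<xi> - g \<xi>\<bar> < e) (at_right 0)"
proof -
  obtain b where b: "0 \<le> b" "\<And>x. \<bar>g x\<bar> \<le> b" using C_b_boundE[OF g] by metis
  have gc: "continuous_on UNIV g" using g by (simp add: C_b_def)
  \<comment> \<open>The mass error \<open>d\<close> enters the final estimate as \<open>8bd\<close>, once for the mass outside the small ball and
    once for the total mass, next to the oscillation \<open>e/4\<close> of \<open>g\<close> on the ball.\<close>
  define d where "d = e / (16 * (b + 1))"
  have d: "0 < d" "16 * (b * d) < e" "0 < e / (4 * mass_bound)"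
    using e b mass_bound(1) by (auto simp: d_def field_simps)
  obtain r where r: "0 < r" "\<And>x y. x \<in> K \<Longrightarrow> dist x y < r \<Longrightarrow> \<bar>g y - g x\<bar> < e / (4 * mass_bound)"
    using compact_uniform_continuity_nearby[OF K gc d(3)] by blast
  obtain K0 where K0: "compact K0"
    "\<And>t \<xi>. t \<in> {0..1} \<Longrightarrow> \<xi> \<in> K \<Longrightarrow> measure (\<nu> t \<xi>) (- K0) < d"
    using tight[OF K d(1) zero_le_one] by metis
  have "bounded (K \<union> K0)" using K K0 by (simp add: compact_imp_bounded)
  then obtain D0 where D0: "\<forall>x\<in>K \<union> K0. \<forall>y\<in>K \<union> K0. dist x y \<le> D0"
    unfolding bounded_two_points by blast
  define D where "D = max D0 0 + 1"
  have D: "\<And>x y. x \<in> K \<Longrightarrow> y \<in> K0 \<Longrightarrow> dist x y < D" "0 < D"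
    using D0 by (force simp: D_def, simp add: D_def)
  have "eventually (\<lambda>t. 0 < t \<and> t < 1) (at_right (0::real))"
    using eventually_at_right_real[of 0 1] by simp
  then show ?thesis
    using mass_near_point[OF K r(1) d(1)] mass_near_point[OF K D(2) d(1)]
  proof eventually_elim
    case (elim t)
    then have t: "0 \<le> t" "t \<in> {0..1}" by auto
    show ?case
    proof
      fix \<xi> assume \<xi>: "\<xi> \<in> K"
      interpret finite_measure "\<nu> t \<xi>" by (rule finite_measure[OF t(1)])
      note sets = sets_borel[OF t(1), of \<xi>] and space = space_ca_plus[OF ca_plus[OF t(1)], of \<xi>]
      let ?m = "measure (\<nu> t \<xi>)"
      have meas: "ball \<xi> D \<in> sets (\<nu> t \<xi>)" "- K0 \<in> sets (\<nu> t \<xi>)"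
        unfolding sets by (simp_all add: borel_comp borel_compact K0(1))
      have "?m UNIV \<le> ?m (ball \<xi> D \<union> - K0)"
        using D(1)[OF \<xi>] by (intro finite_measure_mono sets.Un meas) auto
      also have "\<dots> \<le> ?m (ball \<xi> D) + ?m (- K0)"
        by (rule measure_Un_le[OF meas])
      finally have total: "?m UNIV < 1 + 2 * d" using elim \<xi> K0(2)[OF t(2) \<xi>] by force
      have ball: "\<bar>?m (ball \<xi> r) - 1\<bar> < d" using elim \<xi> by simp
      have compl: "?m (- ball \<xi> r) = ?m UNIV - ?m (ball \<xi> r)"
        using finite_measure_compl[of "ball \<xi> r"] sets space by (simp add: Compl_eq_Diff_UNIV)
      have "?m (ball \<xi> r) \<le> ?m UNIV" by (rule finite_measure_mono) (use sets in auto)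
      then have near: "\<bar>?m UNIV - 1\<bar> < 2 * d" using total ball d(1) by linarith
      have outside: "?m (- ball \<xi> r) < 3 * d" using compl total ball by linarith
      let ?h = "\<lambda>x. g x - g \<xi>"
      have const: "(\<lambda>_. g \<xi>) \<in> C_b" by (rule C_bI[of _ "\<bar>g \<xi>\<bar>"]) auto
      have h: "?h \<in> C_b"
        using C_b_add[OF g C_b_cmult[OF const, of "-1"]] by simp
      have "\<bar>S t ?h \<xi>\<bar> \<le> e / (4 * mass_bound) * mass_bound + 2 * b * ?m (- ball \<xi> r)"
      proof (rule S_split_bound[OF t(1) h])
        show "\<bar>g x - g \<xi>\<bar> \<le> e / (4 * mass_bound)" if "x \<in> ball \<xi> r" for x
          using r(2)[OF \<xi>, of x] that by simp
        show "\<bar>g x - g \<xi>\<bar> \<le> 2 * b" for x using b(2)[of x] b(2)[of \<xi>] by linarith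
      qed (use b(1) d(3) in auto)
      also have "\<dots> \<le> e / 4 + 2 * b * (3 * d)"
        using outside b(1) mass_bound(1) by (intro add_mono mult_left_mono) auto
      finally have 1: "\<bar>S t ?h \<xi>\<bar> \<le> e / 4 + 6 * (b * d)" by simp
      have "S t (\<lambda>_. g \<xi>) \<xi> = g \<xi> * ?m UNIV"
        unfolding transition_operator_def using space by simp
      then have "S t g \<xi> - g \<xi> = S t ?h \<xi> + g \<xi> * (?m UNIV - 1)"
        unfolding S_diff[OF t(1) g const] by (simp add: algebra_simps)
      moreover have "\<bar>g \<xi> * (?m UNIV - 1)\<bar> \<le> b * (2 * d)"
        unfolding abs_mult using near b by (intro mult_mono) auto
      ultimately show "\<bar>S t g \<xi> - g \<xi>\<bar> < e" using 1 d(2) e by linarith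
    qed
  qed
qed

text \<open>For \<open>s < t\<close> the semigroup law gives \<open>S\<^sub>t g - S\<^sub>s g = S\<^sub>s (S\<^bsub>t-s\<^esub> g - g)\<close>, where the argument of \<open>S\<^sub>s\<close> is
  bounded, and small on any given compact set. With \<open>S\<^sub>s\<close> outermost the estimate also covers
  continuity from the left.\<close>

lemma S_uniformly_continuous_in_time:
  assumes K: "compact K" and g: "g \<in> C_b" and e: "0 < e" and a: "0 \<le> a"
  shows "\<exists>\<delta>>0. \<forall>s\<in>{0..a}. \<forall>t\<in>{0..a}. \<bar>t - s\<bar> < \<delta> \<longrightarrow> (\<forall>\<xi>\<in>K. \<bar>S t g \<xi> - S s g \<xi>\<bar> < e)"
proof -
  obtain b where b: "0 \<le> b" "\<And>x. \<bar>g x\<bar> \<le> b" using C_b_boundE[OF g] by metis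
  have "0 \<le> mass_bound * b + b" using mass_bound(1) b(1) by simp
  then obtain K0 d where K0: "compact K0" "0 < d"
    "\<And>h t \<xi>. h \<in> C_b \<Longrightarrow> (\<And>x. \<bar>h x\<bar> \<le> mass_bound * b + b) \<Longrightarrow>
      (\<And>x. x \<in> K0 \<Longrightarrow> \<bar>h x\<bar> \<le> d) \<Longrightarrow> t \<in> {0..a} \<Longrightarrow> \<xi> \<in> K \<Longrightarrow> \<bar>S t h \<xi>\<bar> < e"
    using S_uniformly_small[OF K a e] by metis
  obtain \<delta> where \<delta>: "0 < \<delta>" "\<And>u \<xi>. 0 < u \<Longrightarrow> u < \<delta> \<Longrightarrow> \<xi> \<in> K0 \<Longrightarrow> \<bar>S u g \<xi> - g \<xi>\<bar> < d"
    using S_tendsto_uniformly_on_compact[OF K0(1) g K0(2)]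
    unfolding eventually_at_right_field by (metis)
  have main: "\<bar>S t g \<xi> - S s g \<xi>\<bar> < e"
    if st: "0 \<le> s" "s < t" "t \<le> a" "t - s < \<delta>" and \<xi>: "\<xi> \<in> K" for s t \<xi>
  proof -
    let ?h = "\<lambda>x. S (t - s) g x - g x"
    have Sg: "S (t - s) g \<in> C_b" using st by (intro S_C_b g) simp
    have h: "?h \<in> C_b" using C_b_add[OF Sg C_b_cmult[OF g, of "-1"]] by simp
    have "\<bar>?h x\<bar> \<le> mass_bound * b + b" for x
      using S_bound[OF _ g b(2), of "t - s" x] b(2)[of x] st by linarith
    moreover have "\<bar>?h x\<bar> \<le> d" if "x \<in> K0" for x
      using \<delta>(2)[of "t - s" x] that st by simp
    ultimately have "\<bar>S s ?h \<xi>\<bar> < e" using st \<xi> by (intro K0(3)[OF h]) auto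
    moreover have "S s ?h \<xi> = S t g \<xi> - S s g \<xi>"
      using S_diff[OF st(1) Sg g] S_add[OF st(1) _ g, of "t - s"] st by simp
    ultimately show ?thesis by simp
  qed
  have "\<bar>S t g \<xi> - S s g \<xi>\<bar> < e"
    if "s \<in> {0..a}" "t \<in> {0..a}" "\<bar>t - s\<bar> < \<delta>" "\<xi> \<in> K" for s t \<xi>
    using main[of s t \<xi>] main[of t s \<xi>] that e
    by (cases s t rule: linorder_cases) (auto simp: abs_minus_commute)
  with \<delta>(1) show ?thesis by blast
qed

end

section \<open>Riemann integrals in the weighted topology\<close>

lemma riemann_sum_error:
  fixes H :: "real \<Rightarrow> real"
  assumes a: "0 \<le> a" and H: "continuous_on {0..a} H" and D: "D tagged_division_of {0..a}"
    and mesh: "\<And>x k. (x, k) \<in> D \<Longrightarrow> measure lborel k < \<delta>"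
    and osc: "\<And>s t. s \<in> {0..a} \<Longrightarrow> t \<in> {0..a} \<Longrightarrow> \<bar>t - s\<bar> < \<delta> \<Longrightarrow> \<bar>H t - H s\<bar> \<le> e"
  shows "\<bar>(\<Sum>(x, k)\<in>D. measure lborel k * H x) - integral {0..a} H\<bar> \<le> e * a"
proof -
  have D': "D tagged_division_of cbox 0 a" using D by (simp add: cbox_interval)
  have int: "H integrable_on cbox 0 a" using H by (simp add: cbox_interval integrable_continuous_interval)
  have piece: "\<bar>measure lborel k * H x - integral k H\<bar> \<le> e * measure lborel k" if xk: "(x, k) \<in> D" for x k
  proof -
    obtain u v where k: "k = {u..v}" using tagged_division_ofD(4)[OF D xk] by (auto simp: cbox_interval)
    have x: "x \<in> {u..v}" and sub: "{u..v} \<subseteq> {0..a}"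
      using tagged_division_ofD(2,3)[OF D xk] k by auto
    then have uv: "u \<le> v" by simp
    have len: "v - u < \<delta>" using mesh[OF xk] k uv by simp
    have Hk: "continuous_on {u..v} H" by (rule continuous_on_subset[OF H sub])
    have "measure lborel k * H x - integral k H = integral {u..v} (\<lambda>t. H x - H t)"
      using integral_diff[OF integrable_const_ivl integrable_continuous_interval[OF Hk], of "H x"] k uv
      by simp
    moreover have "norm (integral {u..v} (\<lambda>t. H x - H t)) \<le> e * (v - u)"
    proof (rule integral_bound[OF uv])
      show "continuous_on {u..v} (\<lambda>t. H x - H t)" by (intro continuous_intros Hk)
      show "norm (H x - H t) \<le> e" if t: "t \<in> {u..v}" for t
      proof -
        have "\<bar>x - t\<bar> < \<delta>" using x t len by auto
        then show ?thesis using osc[of t x] x t sub by auto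
      qed
    qed
    ultimately show ?thesis using k uv by simp
  qed
  have "(\<Sum>(x, k)\<in>D. measure lborel k * H x) - integral {0..a} H
      = (\<Sum>w\<in>D. measure lborel (snd w) * H (fst w) - integral (snd w) H)"
    using integral_combine_tagged_division_topdown[OF int D']
    by (simp add: cbox_interval sum_subtractf case_prod_beta)
  also have "\<bar>\<dots>\<bar> \<le> (\<Sum>w\<in>D. e * measure lborel (snd w))"
    by (rule order_trans[OF sum_abs]) (use piece in \<open>auto intro!: sum_mono\<close>)
  also have "\<dots> = e * a"
    using additive_content_tagged_division[OF D'] a
    by (simp add: case_prod_beta flip: sum_distrib_left)
  finally show ?thesis .
qed

lemma sum_fun_apply: "(\<Sum>i\<in>A. f i) x = (\<Sum>i\<in>A. f i x)"
  by (induction A rule: infinite_finite_induct) (auto simp: zero_fun_def plus_fun_def)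

context
  fixes \<gamma> :: "'a::metric_space \<Rightarrow> real" and F :: "real \<Rightarrow> 'a \<Rightarrow> real" and B a :: real
  assumes cont: "continuous_on UNIV \<gamma>" and pos: "\<And>\<xi>. \<gamma> \<xi> > 0"
    and a: "0 \<le> a"
    and F: "\<And>t. t \<in> {0..a} \<Longrightarrow> F t \<in> C_weighted \<gamma>"
    and bound: "\<And>t x. t \<in> {0..a} \<Longrightarrow> \<bar>F t x * \<gamma> x\<bar> \<le> B"
    and unif: "\<And>K e. compact K \<Longrightarrow> 0 < e \<Longrightarrow> \<exists>\<delta>>0. \<forall>s\<in>{0..a}. \<forall>t\<in>{0..a}. \<bar>t - s\<bar> < \<delta> \<longrightarrow>
      (\<forall>x\<in>K. \<bar>F t x * \<gamma> x - F s x * \<gamma> x\<bar> < e)"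
begin

text \<open>A convergent sequence of points together with its limit is compact, so uniformity over compact sets
  suffices although \<open>E\<close> need not be locally compact.\<close>

lemma jointly_continuous: "continuous_on (UNIV \<times> {0..a}) (\<lambda>(x, t). F t x * \<gamma> x)"
  unfolding continuous_on_sequentially
proof (intro allI ballI impI, elim conjE)
  fix w :: "nat \<Rightarrow> 'a \<times> real" and l assume l: "l \<in> UNIV \<times> {0..a}" and w: "\<forall>n. w n \<in> UNIV \<times> {0..a}" "w \<longlonglongrightarrow> l"
  obtain x t where xt: "l = (x, t)" "t \<in> {0..a}" using l by auto
  have x: "(\<lambda>n. fst (w n)) \<longlonglongrightarrow> x" and t: "(\<lambda>n. snd (w n)) \<longlonglongrightarrow> t"
    using tendsto_fst[OF w(2)] tendsto_snd[OF w(2)] xt by auto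
  have tn: "snd (w n) \<in> {0..a}" for n using w(1) by (metis mem_Times_iff)
  let ?K = "insert x (range (\<lambda>n. fst (w n)))"
  let ?H = "\<lambda>x t. F t x * \<gamma> x"
  have K: "compact ?K" 
    using compactin_sequence_with_limit[of euclidean "\<lambda>n. fst (w n)" x "range (\<lambda>n. fst (w n))"] x
    by (simp add: limitin_canonical_iff compactin_euclidean_iff)
  have Hc: "continuous_on UNIV (\<lambda>x. ?H x t)" using F[OF xt(2)] by (simp add: C_weighted_def C_b_def)
  have "(\<lambda>n. ?H (fst (w n)) t) \<longlonglongrightarrow> ?H x t"
    by (rule continuous_on_tendsto_compose[OF Hc x]) auto
  moreover have "(\<lambda>n. ?H (fst (w n)) (snd (w n)) - ?H (fst (w n)) t) \<longlonglongrightarrow> 0"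
  proof (rule tendstoI)
    fix e :: real assume "0 < e"
    then obtain \<delta> where \<delta>: "0 < \<delta>"
      "\<And>s t x. s \<in> {0..a} \<Longrightarrow> t \<in> {0..a} \<Longrightarrow> \<bar>t - s\<bar> < \<delta> \<Longrightarrow> x \<in> ?K \<Longrightarrow> \<bar>?H x t - ?H x s\<bar> < e"
      using unif[OF K] by meson
    have "eventually (\<lambda>n. \<bar>snd (w n) - t\<bar> < \<delta>) sequentially"
      using tendstoD[OF t \<delta>(1)] by (simp add: dist_real_def)
    then show "eventually (\<lambda>n. dist (?H (fst (w n)) (snd (w n)) - ?H (fst (w n)) t) 0 < e) sequentially"
    proof eventually_elim
      case (elim n)
      have "fst (w n) \<in> ?K" by blast
      from \<delta>(2)[OF xt(2) tn elim this] show ?case by (simp add: dist_real_def)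
    qed
  qed
  ultimately have "(\<lambda>n. (?H (fst (w n)) (snd (w n)) - ?H (fst (w n)) t) + ?H (fst (w n)) t) \<longlonglongrightarrow> 0 + ?H x t"
    by (intro tendsto_add)
  then show "((\<lambda>(x, t). ?H x t) \<circ> w) \<longlonglongrightarrow> (case l of (x, t) \<Rightarrow> ?H x t)"
    by (simp add: xt o_def case_prod_beta)
qed

lemma continuous_in_time: "continuous_on {0..a} (\<lambda>t. F t x * \<gamma> x)"
proof -
  have "continuous_on {0..a} ((\<lambda>(x, t). F t x * \<gamma> x) \<circ> Pair x)"
    by (intro continuous_on_compose continuous_intros continuous_on_subset[OF jointly_continuous]) auto
  then show ?thesis by (simp add: o_def)
qed

lemma integral_weighted:
  "integral {0..a} (\<lambda>t. F t x) * \<gamma> x = integral {0..a} (\<lambda>t. F t x * \<gamma> x)"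
  by simp

text \<open>In a space that need not be complete, the value of the integral has to be shown to belong to it.\<close>

lemma integral_C_weighted: "(\<lambda>x. integral {0..a} (\<lambda>t. F t x)) \<in> C_weighted \<gamma>"
proof -
  let ?J = "\<lambda>x. integral {0..a} (\<lambda>t. F t x * \<gamma> x)"
  have "continuous_on UNIV (\<lambda>x. integral (cbox 0 a) (\<lambda>t. F t x * \<gamma> x))"
    using integral_continuous_on_param[of UNIV 0 a "\<lambda>x t. F t x * \<gamma> x"] jointly_continuous
    by (simp add: cbox_interval)
  then have J: "continuous_on UNIV ?J" by (simp add: cbox_interval)
  have "\<bar>?J x\<bar> \<le> B * (a - 0)" for x
    using integral_bound[OF a continuous_in_time, of x B] bound by auto
  then have "?J \<in> C_b" by (rule C_bI[OF J])
  moreover have "continuous_on UNIV (\<lambda>x. ?J x / \<gamma> x)"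
    using pos by (intro continuous_on_divide J cont) (auto simp: less_imp_neq[symmetric])
  moreover have "?J x / \<gamma> x = integral {0..a} (\<lambda>t. F t x)" for x
    using pos[of x] by simp
  ultimately show ?thesis unfolding C_weighted_def by simp
qed

lemma has_riemann_integral_weighted:
  "has_riemann_integral (tau_weighted \<gamma>) F (\<lambda>x. integral {0..a} (\<lambda>t. F t x)) 0 a"
proof -
  interpret seminorm_family "C_weighted \<gamma>" "weighted_seminorms \<gamma>"
    by (rule seminorm_family_weighted[OF pos])
  let ?J = "\<lambda>x. integral {0..a} (\<lambda>t. F t x)"
  define R where "R D = (\<Sum>(t, k)\<in>D. measure lborel k *\<^sub>R F t)" for D :: "(real \<times> real set) set"
  define A where "A n = {D. D tagged_division_of {0..a} \<and> (\<forall>w\<in>D. measure lborel (snd w) < inverse (real (Suc n)))}"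
    for n :: nat
  have A: "decseq A"
  proof (rule decseq_SucI, rule subsetI)
    fix n D assume D: "D \<in> A (Suc n)"
    have "inverse (real (Suc (Suc n))) \<le> inverse (real (Suc n))" by simp
    then have "\<forall>w\<in>D. measure lborel (snd w) < inverse (real (Suc n))" 
      using D less_le_trans unfolding A_def by blast
    then show "D \<in> A n" using D unfolding A_def by simp
  qed
  \<comment> \<open>Multiplying by \<open>\<gamma>\<close> turns the error at a point into that of a real Riemann sum.\<close>
  have R_apply: "R D x * \<gamma> x = (\<Sum>(t, k)\<in>D. measure lborel k * (F t x * \<gamma> x))" for D x
    by (simp add: R_def sum_fun_apply case_prod_beta scaleR_fun_def sum_distrib_right mult.assoc)
  have diff_apply: "(R D - ?J) x * \<gamma> x
      = (\<Sum>(t, k)\<in>D. measure lborel k * (F t x * \<gamma> x)) - integral {0..a} (\<lambda>t. F t x * \<gamma> x)" for D x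
    unfolding fun_diff_def left_diff_distrib R_apply integral_weighted ..
  have RZ: "R D \<in> C_weighted \<gamma>" if "D \<in> A n" for D n
  proof -
    have D: "D tagged_division_of {0..a}" using that by (simp add: A_def)
    have "measure lborel k *\<^sub>R F t \<in> C_weighted \<gamma>" if "(t, k) \<in> D" for t k
      by (intro subspace_scale[OF subspace] F tag_in_interval[OF D that])
    then show ?thesis unfolding R_def by (intro subspace_sum[OF subspace]) (simp add: case_prod_beta)
  qed
  have error: "\<bar>(R D - ?J) x * \<gamma> x\<bar> \<le> e * a"
    if D: "D \<in> A n" and osc: "\<And>s t. s \<in> {0..a} \<Longrightarrow> t \<in> {0..a} \<Longrightarrow> \<bar>t - s\<bar> < inverse (real (Suc n)) \<Longrightarrow>
      \<bar>F t x * \<gamma> x - F s x * \<gamma> x\<bar> \<le> e" for D n x e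
    unfolding diff_apply
  proof (rule riemann_sum_error[OF a continuous_in_time _ _ osc])
    show "D tagged_division_of {0..a}" using D by (simp add: A_def)
    show "measure lborel k < inverse (real (Suc n))" if "(t, k) \<in> D" for t k
      using D that unfolding A_def by fastforce
  qed
  show ?thesis unfolding tau_weighted_eq
  proof (rule has_riemann_integralI)
    show "?J \<in> C_weighted \<gamma>" by (rule integral_C_weighted)
    show "F t \<in> C_weighted \<gamma>" if "t \<in> {0..a}" for t by (rule F[OF that])
    fix p and e :: real assume p: "p \<in> weighted_seminorms \<gamma>" and e: "0 < e"
    have "\<exists>n. \<forall>D\<in>A n. p (R D - ?J) < e"
    proof (rule weighted_seminorm_small[OF _ A _ _ p e])
      show "R D - ?J \<in> C_weighted \<gamma>" if "D \<in> A 0" for D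
        by (intro diff RZ[OF that] integral_C_weighted)
      show "\<bar>(R D - ?J) x * \<gamma> x\<bar> \<le> (2 * B) * a" if D: "D \<in> A 0" for D x
      proof (rule error[OF D])
        show "\<bar>F t x * \<gamma> x - F s x * \<gamma> x\<bar> \<le> 2 * B" if "s \<in> {0..a}" "t \<in> {0..a}" for s t
          using bound[OF that(1), of x] bound[OF that(2), of x] by linarith
      qed
      fix K :: "'a set" and e :: real assume K: "compact K" and e: "0 < e"
      then have "0 < e / (a + 1)" using a by simp
      then obtain \<delta> where \<delta>: "0 < \<delta>" "\<And>s t x. s \<in> {0..a} \<Longrightarrow> t \<in> {0..a} \<Longrightarrow> \<bar>t - s\<bar> < \<delta> \<Longrightarrow>
          x \<in> K \<Longrightarrow> \<bar>F t x * \<gamma> x - F s x * \<gamma> x\<bar> < e / (a + 1)"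
        using unif[OF K] by meson
      obtain n where n: "inverse (real (Suc n)) < \<delta>" using reals_Archimedean[OF \<delta>(1)] by blast
      have "\<bar>(R D - ?J) x * \<gamma> x\<bar> < e" if D: "D \<in> A n" and x: "x \<in> K" for D x
      proof -
        have "\<bar>(R D - ?J) x * \<gamma> x\<bar> \<le> e / (a + 1) * a"
          using \<delta>(2) n x by (intro error[OF D] less_imp_le) auto
        also have "\<dots> < e" using e a by (simp add: field_simps)
        finally show ?thesis .
      qed
      then show "\<exists>n. \<forall>D\<in>A n. \<forall>x\<in>K. \<bar>(R D - ?J) x * \<gamma> x\<bar> < e" by blast
    qed
    then obtain n where "\<And>D. D \<in> A n \<Longrightarrow> p (R D - ?J) < e" by blast
    then show "\<exists>d>0. \<forall>D. D tagged_division_of {0..a} \<and> (\<forall>(x, k)\<in>D. measure lborel k < d) \<longrightarrow>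
        p ((\<Sum>(x, k)\<in>D. measure lborel k *\<^sub>R F x) - ?J) < e"
      unfolding A_def R_def
      by (intro exI[of _ "inverse (real (Suc n))"]) (simp add: case_prod_beta)
  qed
qed

end

text \<open>With exponential decay the integrals over \<open>[0, a]\<close>, multiplied by \<open>\<gamma>\<close>, are uniformly Cauchy as
  \<open>a \<rightarrow> \<infinity>\<close>, so that their limit \<open>L\<close> is continuous and bounded; the limit in the space is \<open>L / \<gamma>\<close>.\<close>

lemma generalized_riemann_integrable_weighted:
  fixes \<gamma> :: "'a::metric_space \<Rightarrow> real" and F :: "real \<Rightarrow> 'a \<Rightarrow> real"
  assumes cont: "continuous_on UNIV \<gamma>" and pos: "\<And>\<xi>. \<gamma> \<xi> > 0" and c: "0 < c"
    and F: "\<And>t. 0 \<le> t \<Longrightarrow> F t \<in> C_weighted \<gamma>"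
    and bound: "\<And>t x. 0 \<le> t \<Longrightarrow> \<bar>F t x * \<gamma> x\<bar> \<le> B * exp (- c * t)"
    and unif: "\<And>K e a. compact K \<Longrightarrow> 0 < e \<Longrightarrow> 0 \<le> a \<Longrightarrow>
      \<exists>\<delta>>0. \<forall>s\<in>{0..a}. \<forall>t\<in>{0..a}. \<bar>t - s\<bar> < \<delta> \<longrightarrow> (\<forall>x\<in>K. \<bar>F t x * \<gamma> x - F s x * \<gamma> x\<bar> < e)"
  shows "generalized_riemann_integrable (tau_weighted \<gamma>) F"
proof -
  interpret seminorm_family "C_weighted \<gamma>" "weighted_seminorms \<gamma>"
    by (rule seminorm_family_weighted[OF pos])
  let ?H = "\<lambda>x t. F t x * \<gamma> x"
  define J where "J a x = integral {0..a} (\<lambda>t. F t x)" for a x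
  \<comment> \<open>This is the integral of the majorant \<open>B exp (-ct)\<close> over \<open>[a, \<infinity>)\<close>.\<close>
  define r where "r a = B / c * exp (- c * a)" for a
  have B: "0 \<le> B" using bound[of 0 undefined] by (simp add: order_trans[OF abs_ge_zero])
  have boundB: "\<bar>?H x t\<bar> \<le> B" if "0 \<le> t" for x t
  proof -
    have "exp (- c * t) \<le> 1" using c that by simp
    then have "B * exp (- c * t) \<le> B" using B mult_left_le by blast
    then show ?thesis using bound[OF that, of x] by linarith
  qed
  have riemann: "has_riemann_integral (tau_weighted \<gamma>) F (J a) 0 a"
    and JZ: "J a \<in> C_weighted \<gamma>" and Hc: "continuous_on {0..a} (?H x)" if a: "0 \<le> a" for a x
    unfolding J_def
    by (rule has_riemann_integral_weighted[OF cont pos a, where B=B]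
        integral_C_weighted[OF cont pos a, where B=B] continuous_in_time[OF cont pos a, where B=B];
        use F boundB unif a in auto)+
  have r0: "0 \<le> r a" for a using B c by (simp add: r_def)
  have r_mono: "r b \<le> r a" if "a \<le> b" for a b
    using B c that by (auto simp: r_def intro!: mult_left_mono divide_right_mono)
  have r_lim: "(r \<longlongrightarrow> 0) at_top"
  proof -
    have "filterlim (\<lambda>a. - (c * a)) at_bot at_top"
      using filterlim_tendsto_pos_mult_at_top[OF tendsto_const c filterlim_ident]
      by (simp add: filterlim_uminus_at_bot)
    then have "((\<lambda>a. exp (- (c * a))) \<longlongrightarrow> 0) at_top" by (rule filterlim_compose[OF exp_at_bot])
    then have "((\<lambda>a. B / c * exp (- (c * a))) \<longlongrightarrow> B / c * 0) at_top" by (intro tendsto_mult_left)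
    then show ?thesis by (simp add: r_def[abs_def])
  qed
  have J_weighted: "J a x * \<gamma> x = integral {0..a} (?H x)" for a x by (simp add: J_def)
  have tail: "\<bar>J b x * \<gamma> x - J a x * \<gamma> x\<bar> \<le> r a" if ab: "0 \<le> a" "a \<le> b" for a b x
  proof -
    have b: "0 \<le> b" using ab by simp
    have int: "?H x integrable_on {0..b}" by (rule integrable_continuous_interval[OF Hc[OF b]])
    have "J b x * \<gamma> x - J a x * \<gamma> x = integral {a..b} (?H x)"
      unfolding J_weighted using Henstock_Kurzweil_Integration.integral_combine[OF ab int] by simp
    also have "norm \<dots> \<le> integral {a..b} (\<lambda>t. B * exp (- c * t))"
    proof (rule integral_norm_bound_integral)
      show "?H x integrable_on {a..b}" by (rule integrable_on_subinterval[OF int]) (use ab in auto)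
      show "(\<lambda>t. B * exp (- c * t)) integrable_on {a..b}"
        by (intro integrable_continuous_interval continuous_intros)
      show "norm (?H x t) \<le> B * exp (- c * t)" if "t \<in> {a..b}" for t
        using bound[of t x] that ab by simp
    qed
    also have "integral {a..b} (\<lambda>t. B * exp (- c * t)) = (- r b) - (- r a)"
    proof (rule integral_unique, rule fundamental_theorem_of_calculus[OF ab(2)])
      fix t
      have "((\<lambda>t. - r t) has_real_derivative B * exp (- c * t)) (at t within {a..b})"
        unfolding r_def using c by (auto intro!: derivative_eq_intros)
      then show "((\<lambda>t. - r t) has_vector_derivative B * exp (- c * t)) (at t within {a..b})"
        by (simp add: has_real_derivative_iff_has_vector_derivative)
    qed
    finally show ?thesis using r0[of b] by simp
  qed
  have small_r: "\<exists>N. r (real N) < e" if "0 < e" for e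
  proof -
    have "eventually (\<lambda>a. r a < e) at_top" using r_lim that by (rule order_tendstoD(2))
    then obtain a0 where "\<And>a. a0 \<le> a \<Longrightarrow> r a < e" by (auto simp: eventually_at_top_linorder)
    then show ?thesis using real_arch_simple[of a0] by blast
  qed
  define L where "L x = lim (\<lambda>n. J (real n) x * \<gamma> x)" for x
  have L: "(\<lambda>n. J (real n) x * \<gamma> x) \<longlonglongrightarrow> L x" for x
  proof -
    have "Cauchy (\<lambda>n. J (real n) x * \<gamma> x)"
    proof (rule CauchyI')
      fix e :: real assume "0 < e"
      then obtain N where N: "r (real N) < e" using small_r by blast
      have "dist (J (real m) x * \<gamma> x) (J (real n) x * \<gamma> x) < e" if "N \<le> m" "m < n" for m n
        using tail[of "real m" "real n" x] r_mono[of "real N" "real m"] N that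
        by (simp add: dist_real_def abs_minus_commute)
      then show "\<exists>M. \<forall>m\<ge>M. \<forall>n>m. dist (J (real m) x * \<gamma> x) (J (real n) x * \<gamma> x) < e" by blast
    qed
    then show ?thesis unfolding L_def by (simp add: Cauchy_convergent_iff convergent_LIMSEQ_iff)
  qed
  have L_tail: "\<bar>J a x * \<gamma> x - L x\<bar> \<le> r a" if a: "0 \<le> a" for a x
  proof -
    have "(\<lambda>n. \<bar>J a x * \<gamma> x - J (real n) x * \<gamma> x\<bar>) \<longlonglongrightarrow> \<bar>J a x * \<gamma> x - L x\<bar>"
      by (intro tendsto_intros L)
    moreover have "\<exists>N. \<forall>n\<ge>N. \<bar>J a x * \<gamma> x - J (real n) x * \<gamma> x\<bar> \<le> r a"
    proof -
      obtain N where N: "a \<le> real N" using real_arch_simple by blast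
      have "\<bar>J a x * \<gamma> x - J (real n) x * \<gamma> x\<bar> \<le> r a" if "N \<le> n" for n
        using tail[OF a, of "real n" x] N that by (simp add: abs_minus_commute)
      then show ?thesis by blast
    qed
    ultimately show ?thesis by (rule LIMSEQ_le_const2)
  qed
  have "uniform_limit UNIV (\<lambda>n x. J (real n) x * \<gamma> x) L sequentially"
  proof (rule uniform_limitI)
    fix e :: real assume "0 < e"
    then obtain N where N: "r (real N) < e" using small_r by blast
    have "dist (J (real n) x * \<gamma> x) (L x) < e" if "N \<le> n" for n x
      using L_tail[of "real n" x] r_mono[of "real N" "real n"] N that by (simp add: dist_real_def)
    then show "eventually (\<lambda>n. \<forall>x\<in>UNIV. dist (J (real n) x * \<gamma> x) (L x) < e) sequentially"
      by (auto simp: eventually_sequentially)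
  qed
  moreover have "continuous_on UNIV (\<lambda>x. J (real n) x * \<gamma> x)" for n
    using JZ[of "real n"] by (simp add: C_weighted_def C_b_def)
  ultimately have Lc: "continuous_on UNIV L" by (intro uniform_limit_theorem) auto
  have Lb: "L \<in> C_b" using L_tail[of 0] by (intro C_bI[OF Lc, of "r 0"]) (simp add: J_def)
  define Z where "Z x = L x / \<gamma> x" for x
  have Zw: "Z x * \<gamma> x = L x" for x using pos[of x] by (simp add: Z_def)
  have "continuous_on UNIV Z"
    unfolding Z_def[abs_def] using pos by (intro continuous_on_divide Lc cont) (auto simp: less_imp_neq[symmetric])
  then have Z: "Z \<in> C_weighted \<gamma>" using Lb by (simp add: C_weighted_def Zw)
  have "limitin (tau_weighted \<gamma>) J Z at_top"
    unfolding tau_weighted_eq limitin_iff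
  proof (intro conjI ballI allI impI Z)
    show "eventually (\<lambda>a. J a \<in> C_weighted \<gamma>) at_top"
      using eventually_ge_at_top[of 0] by eventually_elim (rule JZ)
    fix p and e :: real assume p: "p \<in> weighted_seminorms \<gamma>" and e: "0 < e"
    have dist_le: "\<bar>(J a - Z) x * \<gamma> x\<bar> \<le> r (real n)" if "a \<in> {real n..}" for a x n
      using L_tail[of a x] r_mono[of "real n" a] that by (simp add: left_diff_distrib Zw)
    have "\<exists>n. \<forall>a\<in>{real n..}. p (J a - Z) < e"
    proof (rule weighted_seminorm_small[OF _ _ _ _ p e])
      show "J a - Z \<in> C_weighted \<gamma>" if "a \<in> {real 0..}" for a using that by (intro diff JZ Z) simp
      show "decseq (\<lambda>n. {real n..})" by (auto simp: decseq_def)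
      show "\<bar>(J a - Z) x * \<gamma> x\<bar> \<le> r (real 0)" if "a \<in> {real 0..}" for a x by (rule dist_le[OF that])
      fix K :: "'a set" and e :: real assume "0 < e"
      then obtain N where "r (real N) < e" using small_r by blast
      then show "\<exists>n. \<forall>a\<in>{real n..}. \<forall>x\<in>K. \<bar>(J a - Z) x * \<gamma> x\<bar> < e"
        using dist_le le_less_trans by blast
    qed
    then show "eventually (\<lambda>a. p (J a - Z) < e) at_top"
      unfolding eventually_at_top_linorder by (meson atLeast_iff)
  qed
  then show ?thesis unfolding generalized_riemann_integrable_def using riemann by blast
qed

section \<open>The transition semigroup\<close>

lemma scale_measure_eq_density: "scale_measure r M = density M (\<lambda>_. r)"
  by (rule measure_eqI) (auto simp: emeasure_density_const)

text \<open>Multiplication by \<open>\<gamma>\<close> intertwines the two families. The identity includes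
  functions \<open>f\<close> that are not integrable: then both integrals are \<open>0\<close> by convention.\<close>

lemma transition_operator_weighted:
  assumes cont: "continuous_on UNIV \<gamma>" and pos: "\<And>\<xi>. \<gamma> \<xi> > 0" and M: "\<mu> t \<xi> \<in> ca_plus"
    and f: "continuous_on UNIV f"
  shows "transition_operator \<mu> t f \<xi> * \<gamma> \<xi>
    = transition_operator (weighted_family \<gamma> \<mu>) t (\<lambda>x. f x * \<gamma> x) \<xi>"
proof -
  have meas: "\<gamma> \<in> borel_measurable (\<mu> t \<xi>)" "f \<in> borel_measurable (\<mu> t \<xi>)"
    by (rule measurable_ca_plus[OF M cont] measurable_ca_plus[OF M f])+
  have "(\<integral>x. f x * \<gamma> x \<partial>weighted_family \<gamma> \<mu> t \<xi>)
      = (\<integral>x. \<gamma> \<xi> *\<^sub>R (f x * \<gamma> x) \<partial>density (\<mu> t \<xi>) (\<lambda>x. ennreal (inverse (\<gamma> x))))"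
    unfolding weighted_family_def scale_measure_eq_density
    by (rule integral_density) (use meas pos[of \<xi>] in \<open>auto simp: less_imp_le\<close>)
  also have "\<dots> = (\<integral>x. inverse (\<gamma> x) *\<^sub>R \<gamma> \<xi> *\<^sub>R (f x * \<gamma> x) \<partial>\<mu> t \<xi>)"
    by (rule integral_density) (use meas pos in \<open>auto simp: less_imp_le\<close>)
  also have "\<dots> = (\<integral>x. \<gamma> \<xi> * f x \<partial>\<mu> t \<xi>)"
  proof (rule Bochner_Integration.integral_cong[OF refl])
    show "inverse (\<gamma> x) *\<^sub>R \<gamma> \<xi> *\<^sub>R (f x * \<gamma> x) = \<gamma> \<xi> * f x" for x
      using pos[of x] by (simp add: field_simps)
  qed
  finally show ?thesis by (simp add: transition_operator_def mult.commute)
qed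

lemma abs_add_less_halves:
  fixes p q :: real
  shows "\<bar>p\<bar> \<le> s \<Longrightarrow> s < e / 2 \<Longrightarrow> \<bar>q\<bar> \<le> e / 2 \<Longrightarrow> \<bar>p + q\<bar> < e"
  by linarith

locale weighted_kernel_semigroup =
  fixes \<gamma> :: "'a::metric_space \<Rightarrow> real" and \<mu> :: "real \<Rightarrow> 'a \<Rightarrow> 'a measure"
  assumes cont: "continuous_on UNIV \<gamma>" and pos: "\<And>\<xi>. \<gamma> \<xi> > 0"
    and mu: "\<And>t \<xi>. t \<ge> 0 \<Longrightarrow> \<mu> t \<xi> \<in> ca_plus"
    and kernel: "kernel_semigroup (weighted_family \<gamma> \<mu>)"
begin

sublocale kernel_semigroup "weighted_family \<gamma> \<mu>" by (rule kernel)

sublocale seminorm_family "C_weighted \<gamma>" "weighted_seminorms \<gamma>"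
  by (rule seminorm_family_weighted[OF pos])

abbreviation Tr where "Tr \<equiv> transition_operator \<mu>"

lemma Tr_weighted:
  "t \<ge> 0 \<Longrightarrow> f \<in> C_weighted \<gamma> \<Longrightarrow> Tr t f x * \<gamma> x = S t (\<lambda>y. f y * \<gamma> y) x"
  by (rule transition_operator_weighted[OF cont pos mu]) (simp_all add: C_weighted_def)

lemma Tr_C_weighted:
  assumes t: "t \<ge> 0" and f: "f \<in> C_weighted \<gamma>"
  shows "Tr t f \<in> C_weighted \<gamma>"
proof -
  have C: "(\<lambda>x. Tr t f x * \<gamma> x) \<in> C_b"
    unfolding Tr_weighted[OF t f] by (rule S_C_b[OF t weighted_C_b[OF f]])
  then have "continuous_on UNIV (\<lambda>x. Tr t f x * \<gamma> x / \<gamma> x)"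
    using pos by (intro continuous_on_divide cont) (auto simp: C_b_def less_imp_neq[symmetric])
  moreover have "Tr t f x * \<gamma> x / \<gamma> x = Tr t f x" for x using pos[of x] by simp
  ultimately show ?thesis using C by (simp add: C_weighted_def)
qed

lemma weighted_eqI: "(\<And>x. f x * \<gamma> x = g x * \<gamma> x) \<Longrightarrow> f = g"
  using pos by (auto simp: fun_eq_iff) (metis less_irrefl mult_cancel_right)

lemma Tr_linear:
  assumes t: "t \<ge> 0" and f: "f \<in> C_weighted \<gamma>"
  shows "g \<in> C_weighted \<gamma> \<Longrightarrow> Tr t (f + g) = Tr t f + Tr t g"
    and "g \<in> C_weighted \<gamma> \<Longrightarrow> Tr t (f - g) = Tr t f - Tr t g"
    and "Tr t (a *\<^sub>R f) = a *\<^sub>R Tr t f"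
proof -
  note Z = subspace_add[OF subspace] subspace_diff[OF subspace] subspace_scale[OF subspace]
  show "Tr t (f + g) = Tr t f + Tr t g" if g: "g \<in> C_weighted \<gamma>"
  proof (rule weighted_eqI)
    fix x
    have "Tr t (f + g) x * \<gamma> x = S t (\<lambda>y. f y * \<gamma> y + g y * \<gamma> y) x"
      using Tr_weighted[OF t Z(1)[OF f g], of x] by (simp add: plus_fun_def distrib_right)
    also have "\<dots> = S t (\<lambda>y. f y * \<gamma> y) x + S t (\<lambda>y. g y * \<gamma> y) x"
      unfolding transition_operator_def
      by (intro Bochner_Integration.integral_add integrable t weighted_C_b f g)
    finally show "Tr t (f + g) x * \<gamma> x = (Tr t f + Tr t g) x * \<gamma> x"
      using Tr_weighted[OF t f, of x] Tr_weighted[OF t g, of x] by (simp add: plus_fun_def distrib_right)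
  qed
  show "Tr t (f - g) = Tr t f - Tr t g" if g: "g \<in> C_weighted \<gamma>"
  proof (rule weighted_eqI)
    fix x
    have "Tr t (f - g) x * \<gamma> x = S t (\<lambda>y. f y * \<gamma> y - g y * \<gamma> y) x"
      using Tr_weighted[OF t Z(2)[OF f g], of x] by (simp add: fun_diff_def left_diff_distrib)
    also have "\<dots> = S t (\<lambda>y. f y * \<gamma> y) x - S t (\<lambda>y. g y * \<gamma> y) x"
      by (intro S_diff t weighted_C_b f g)
    finally show "Tr t (f - g) x * \<gamma> x = (Tr t f - Tr t g) x * \<gamma> x"
      using Tr_weighted[OF t f, of x] Tr_weighted[OF t g, of x] by (simp add: fun_diff_def left_diff_distrib)
  qed
  show "Tr t (a *\<^sub>R f) = a *\<^sub>R Tr t f"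
    by (simp add: transition_operator_def scaleR_fun_def fun_eq_iff)
qed

lemma Tr_0: "f \<in> C_weighted \<gamma> \<Longrightarrow> Tr 0 f = f"
  by (rule weighted_eqI) (simp add: Tr_weighted S_0 weighted_C_b)

lemma Tr_add:
  assumes t: "t \<ge> 0" "s \<ge> 0" and f: "f \<in> C_weighted \<gamma>"
  shows "Tr (t + s) f = Tr t (Tr s f)"
proof (rule weighted_eqI)
  fix x
  have "Tr (t + s) f x * \<gamma> x = S (t + s) (\<lambda>y. f y * \<gamma> y) x" using t f by (intro Tr_weighted) auto
  also have "\<dots> = S t (S s (\<lambda>y. f y * \<gamma> y)) x" using S_add[OF t weighted_C_b[OF f]] by simp
  also have "S s (\<lambda>y. f y * \<gamma> y) = (\<lambda>y. Tr s f y * \<gamma> y)" using Tr_weighted[OF t(2) f] by simp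
  also have "S t \<dots> x = Tr t (Tr s f) x * \<gamma> x"
    using Tr_weighted[OF t(1) Tr_C_weighted[OF t(2) f]] by simp
  finally show "Tr (t + s) f x * \<gamma> x = Tr t (Tr s f) x * \<gamma> x" .
qed

text \<open>Treating all rescalings at once covers the semigroup itself (\<open>\<alpha> = 0\<close>) and the normalized ones.\<close>

abbreviation U where "U \<alpha> \<equiv> (\<lambda>t f. exp (- \<alpha> * t) *\<^sub>R Tr t f)"

lemma U_weighted:
  "t \<ge> 0 \<Longrightarrow> f \<in> C_weighted \<gamma> \<Longrightarrow> U \<alpha> t f x * \<gamma> x = exp (- \<alpha> * t) * S t (\<lambda>y. f y * \<gamma> y) x"
  by (simp add: scaleR_fun_def mult.assoc Tr_weighted)

lemma U_C_weighted: "t \<ge> 0 \<Longrightarrow> f \<in> C_weighted \<gamma> \<Longrightarrow> U \<alpha> t f \<in> C_weighted \<gamma>"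
  by (intro subspace_scale[OF subspace] Tr_C_weighted)

lemma U_tendsto:
  assumes \<alpha>: "0 \<le> \<alpha>" and z: "z \<in> C_weighted \<gamma>"
  shows "limitin (tau_weighted \<gamma>) (\<lambda>t. U \<alpha> t z) z (at_right 0)"
  unfolding tau_weighted_eq limitin_iff
proof (intro conjI ballI allI impI z)
  have pos_t: "eventually (\<lambda>t. 0 < t) (at_right (0::real))" by (rule eventually_at_right_less)
  then show "eventually (\<lambda>t. U \<alpha> t z \<in> C_weighted \<gamma>) (at_right 0)"
    by eventually_elim (rule U_C_weighted[OF less_imp_le z])
  let ?g = "\<lambda>y. z y * \<gamma> y"
  note g = weighted_C_b[OF z]
  obtain b where b: "0 \<le> b" "\<And>x. \<bar>?g x\<bar> \<le> b" using C_b_boundE[OF g] by metis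
  have eq: "(U \<alpha> t z - z) x * \<gamma> x = exp (- \<alpha> * t) * S t ?g x - ?g x" if "0 \<le> t" for t x
    using U_weighted[OF that z, of \<alpha> x] by (simp add: fun_diff_def left_diff_distrib)
  have exp_le: "exp (- \<alpha> * t) \<le> 1" if "0 \<le> t" for t using \<alpha> that by simp
  fix p and e :: real assume p: "p \<in> weighted_seminorms \<gamma>" and e: "0 < e"
  have "\<exists>n. \<forall>t\<in>{0<..<inverse (real (Suc n))}. p (U \<alpha> t z - z) < e"
  proof (rule weighted_seminorm_small[OF _ _ _ _ p e])
    show "U \<alpha> t z - z \<in> C_weighted \<gamma>" if "t \<in> {0<..<inverse (real (Suc 0))}" for t
      using that by (intro diff U_C_weighted z) simp
    show "decseq (\<lambda>n. {0<..<inverse (real (Suc n))})"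
    proof (rule decseq_SucI)
      fix n
      have "inverse (real (Suc (Suc n))) \<le> inverse (real (Suc n))" by simp
      then show "{0<..<inverse (real (Suc (Suc n)))} \<subseteq> {0<..<inverse (real (Suc n))}"
        by (meson greaterThanLessThan_iff less_le_trans subsetI)
    qed
    show "\<bar>(U \<alpha> t z - z) x * \<gamma> x\<bar> \<le> mass_bound * b + b" if "t \<in> {0<..<inverse (real (Suc 0))}" for t x
    proof -
      have t: "0 \<le> t" using that by simp
      have "\<bar>exp (- \<alpha> * t) * S t ?g x\<bar> \<le> 1 * (mass_bound * b)"
        unfolding abs_mult using exp_le[OF t] S_bound[OF t g b(2)] by (intro mult_mono) auto
      then show ?thesis unfolding eq[OF t] using b(2)[of x] by linarith
    qed
    fix K :: "'a set" and e :: real assume K: "compact K" and e: "0 < e"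
    have "((\<lambda>t. \<bar>exp (- \<alpha> * t) - 1\<bar> * b) \<longlongrightarrow> \<bar>exp (- \<alpha> * 0) - 1\<bar> * b) (at_right 0)"
      by (intro tendsto_intros)
    then have "eventually (\<lambda>t. \<bar>exp (- \<alpha> * t) - 1\<bar> * b < e / 2) (at_right 0)"
      using e by (intro order_tendstoD(2)) auto
    moreover have "eventually (\<lambda>t. \<forall>x\<in>K. \<bar>S t ?g x - ?g x\<bar> < e / 2) (at_right 0)"
      using e by (intro S_tendsto_uniformly_on_compact[OF K g]) simp
    ultimately have "eventually (\<lambda>t. \<forall>x\<in>K. \<bar>(U \<alpha> t z - z) x * \<gamma> x\<bar> < e) (at_right 0)"
      using pos_t
    proof eventually_elim
      case (elim t)
      then have t: "0 \<le> t" by simp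
      show ?case
      proof
        fix x assume x: "x \<in> K"
        have sum: "(U \<alpha> t z - z) x * \<gamma> x = exp (- \<alpha> * t) * (S t ?g x - ?g x) + (exp (- \<alpha> * t) - 1) * ?g x"
          unfolding eq[OF t] by (simp add: algebra_simps)
        have "\<bar>exp (- \<alpha> * t) * (S t ?g x - ?g x)\<bar> \<le> \<bar>S t ?g x - ?g x\<bar>"
          unfolding abs_mult using exp_le[OF t] by (intro mult_left_le_one_le) auto
        moreover have "\<bar>S t ?g x - ?g x\<bar> < e / 2" using elim x by blast
        moreover have "\<bar>(exp (- \<alpha> * t) - 1) * ?g x\<bar> \<le> \<bar>exp (- \<alpha> * t) - 1\<bar> * b"
          unfolding abs_mult[of "exp (- \<alpha> * t) - 1"] using b(2)[of x] by (intro mult_left_mono) auto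
        then have "\<bar>(exp (- \<alpha> * t) - 1) * ?g x\<bar> \<le> e / 2"
          by (rule order_trans) (use elim(1) in simp)
        ultimately show "\<bar>(U \<alpha> t z - z) x * \<gamma> x\<bar> < e" unfolding sum by (rule abs_add_less_halves)
      qed
    qed
    then obtain d where d: "0 < d"
      "\<And>t x. 0 < t \<Longrightarrow> t < d \<Longrightarrow> x \<in> K \<Longrightarrow> \<bar>(U \<alpha> t z - z) x * \<gamma> x\<bar> < e"
      unfolding eventually_at_right_field by metis
    obtain n where "inverse (real (Suc n)) < d" using reals_Archimedean[OF d(1)] by blast
    then show "\<exists>n. \<forall>t\<in>{0<..<inverse (real (Suc n))}. \<forall>x\<in>K. \<bar>(U \<alpha> t z - z) x * \<gamma> x\<bar> < e"
      using d(2) by (intro exI[of _ n]) auto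
  qed
  then obtain n where n: "\<And>t. t \<in> {0<..<inverse (real (Suc n))} \<Longrightarrow> p (U \<alpha> t z - z) < e" by blast
  have "eventually (\<lambda>t. t \<in> {0<..<inverse (real (Suc n))}) (at_right 0)"
    by (rule eventually_at_right_real) simp
  then show "eventually (\<lambda>t. p (U \<alpha> t z - z) < e) (at_right 0)"
    by eventually_elim (rule n)
qed

lemma U_C0_semigroup:
  assumes \<alpha>: "0 \<le> \<alpha>"
  shows "C0_semigroup (tau_weighted \<gamma>) (U \<alpha>)"
  unfolding C0_semigroup_def topspace_tau_weighted
proof (intro conjI allI ballI impI)
  show "hausdorff_lcs (tau_weighted \<gamma>)" unfolding tau_weighted_eq by (rule hausdorff_lcs)
  show "linear_operator_on (C_weighted \<gamma>) (U \<alpha> t)" if t: "0 \<le> t" for t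
    unfolding linear_operator_on_def using U_C_weighted[OF t] Tr_linear[OF t]
    by (auto simp: scaleR_add_right scaleR_left_commute)
  show "U \<alpha> 0 z = z" if "z \<in> C_weighted \<gamma>" for z using Tr_0[OF that] by simp
  show "U \<alpha> (t + s) z = U \<alpha> t (U \<alpha> s z)" if "0 \<le> t" "0 \<le> s" "z \<in> C_weighted \<gamma>" for t s z
    using Tr_add[OF that] Tr_linear(3)[OF that(1) Tr_C_weighted[OF that(2,3)]]
    by (simp add: algebra_simps exp_add exp_diff exp_minus field_simps)
  show "limitin (tau_weighted \<gamma>) (\<lambda>t. U \<alpha> t z) z (at_right 0)" if "z \<in> C_weighted \<gamma>" for z
    by (rule U_tendsto[OF \<alpha> that])
qed

text \<open>The hypothesis on \<open>I\<close> covers bounded \<open>I\<close> with \<open>\<alpha> = 0\<close>, and unbounded \<open>I\<close> with \<open>\<alpha> > 0\<close>. Up to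
  the time \<open>R\<close>, tightness makes the images small on a compact set; after \<open>R\<close> the exponential factor beats
  the uniform bound.\<close>

lemma U_seq_equicontinuous:
  assumes \<alpha>: "0 \<le> \<alpha>" and I: "I \<subseteq> {0..}"
    and decay: "\<And>e. 0 < e \<Longrightarrow> \<exists>R\<ge>0. \<forall>t\<in>I. R < t \<longrightarrow> exp (- \<alpha> * t) < e"
  shows "seq_equicontinuous (tau_weighted \<gamma>) I (U \<alpha>)"
  unfolding tau_weighted_eq
proof (rule seq_equicontinuousI)
  show "U \<alpha> t \<in> C_weighted \<gamma> \<rightarrow> C_weighted \<gamma>" if "t \<in> I" for t
    using U_C_weighted I that by auto
  fix zs :: "nat \<Rightarrow> 'a \<Rightarrow> real" and z p and e :: real
  assume zs: "\<And>n. zs n \<in> C_weighted \<gamma>"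
    and lim: "limitin (seminorm_topology (C_weighted \<gamma>) (weighted_seminorms \<gamma>)) zs z sequentially"
    and p: "p \<in> weighted_seminorms \<gamma>" and e: "0 < e"
  have z: "z \<in> C_weighted \<gamma>" using lim unfolding limitin_iff by simp
  note lim' = lim[folded tau_weighted_eq]
  obtain B where B: "\<And>n x. \<bar>(zs n - z) x * \<gamma> x\<bar> \<le> B"
    using limitin_weighted_bounded(1)[OF pos zs lim'] by blast
  have B0: "0 \<le> B" using B[of 0 undefined] by (rule order_trans[OF abs_ge_zero])
  have d: "zs n - z \<in> C_weighted \<gamma>" for n by (rule diff[OF zs z])
  have dC: "(\<lambda>x. (zs n - z) x * \<gamma> x) \<in> C_b" for n by (rule weighted_C_b[OF d])
  let ?h = "\<lambda>w. U \<alpha> (fst w) (zs (snd w)) - U \<alpha> (fst w) z"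
  have h: "?h (t, n) x * \<gamma> x = exp (- \<alpha> * t) * S t (\<lambda>x. (zs n - z) x * \<gamma> x) x"
    if t: "0 \<le> t" for t n x
  proof -
    have "?h (t, n) = U \<alpha> t (zs n - z)"
      using Tr_linear(2)[OF t zs z] by (simp add: scaleR_diff_right)
    then show ?thesis using U_weighted[OF t d] by simp
  qed
  have exp_le: "exp (- \<alpha> * t) \<le> 1" if "0 \<le> t" for t using \<alpha> that by simp
  have h_le: "\<bar>?h (t, n) x * \<gamma> x\<bar> \<le> exp (- \<alpha> * t) * (mass_bound * B)" if t: "0 \<le> t" for t n x
    unfolding h[OF t] abs_mult using S_bound[OF t dC B] by (intro mult_mono) auto
  have MB: "0 \<le> mass_bound * B" using mass_bound(1) B0 by simp
  have "\<exists>m. \<forall>w\<in>I \<times> {m..}. p (?h w) < e"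
  proof (rule weighted_seminorm_small[OF _ _ _ _ p e])
    show "?h w \<in> C_weighted \<gamma>" if "w \<in> I \<times> {0..}" for w
      using that I by (intro diff U_C_weighted zs z) auto
    show "decseq (\<lambda>m. I \<times> {m..})" by (auto simp: decseq_def)
    show "\<bar>?h w x * \<gamma> x\<bar> \<le> mass_bound * B" if wI: "w \<in> I \<times> {0..}" for w x
    proof -
      obtain t n where w: "w = (t, n)" "0 \<le> t" using wI I by (cases w) auto
      have "exp (- \<alpha> * t) * (mass_bound * B) \<le> 1 * (mass_bound * B)"
        by (rule mult_right_mono[OF exp_le[OF w(2)] MB])
      then show ?thesis using h_le[OF w(2), of n x] unfolding w(1) by linarith
    qed
    fix K :: "'a set" and e :: real assume K: "compact K" and e: "0 < e"
    have "0 < e / (mass_bound * B + 1)" using MB e by simp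
    then obtain R where R: "0 \<le> R" "\<And>t. t \<in> I \<Longrightarrow> R < t \<Longrightarrow> exp (- \<alpha> * t) < e / (mass_bound * B + 1)"
      using decay by meson
    obtain K0 d where K0: "compact K0" "0 < d" "\<And>g t x. g \<in> C_b \<Longrightarrow> (\<And>x. \<bar>g x\<bar> \<le> B) \<Longrightarrow>
        (\<And>x. x \<in> K0 \<Longrightarrow> \<bar>g x\<bar> \<le> d) \<Longrightarrow> t \<in> {0..R} \<Longrightarrow> x \<in> K \<Longrightarrow> \<bar>S t g x\<bar> < e"
      using S_uniformly_small[OF K R(1) e B0] by metis
    obtain N where N: "\<And>n x. N \<le> n \<Longrightarrow> x \<in> K0 \<Longrightarrow> \<bar>(zs n - z) x * \<gamma> x\<bar> < d"
      using limitin_weighted_bounded(2)[OF pos zs lim' K0(1,2)] by blast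
    have "\<bar>?h (t, n) x * \<gamma> x\<bar> < e" if t: "t \<in> I" and n: "N \<le> n" and x: "x \<in> K" for t n x
    proof (cases "t \<le> R")
      case True
      have t0: "0 \<le> t" using t I by auto
      have "\<bar>S t (\<lambda>x. (zs n - z) x * \<gamma> x) x\<bar> < e"
        using N[OF n] True t0 x by (intro K0(3)[OF dC B]) (auto intro: less_imp_le)
      moreover have "\<bar>exp (- \<alpha> * t) * S t (\<lambda>x. (zs n - z) x * \<gamma> x) x\<bar>
          \<le> 1 * \<bar>S t (\<lambda>x. (zs n - z) x * \<gamma> x) x\<bar>"
        unfolding abs_mult using exp_le[OF t0] by (intro mult_right_mono) auto
      ultimately show ?thesis unfolding h[OF t0] by simp
    next
      case False
      have t0: "0 \<le> t" using t I by auto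
      have "exp (- \<alpha> * t) * (mass_bound * B) \<le> e / (mass_bound * B + 1) * (mass_bound * B)"
        using R(2)[OF t] False MB by (intro mult_right_mono) auto
      also have "\<dots> < e" using MB e by (simp add: field_simps)
      finally show ?thesis using h_le[OF t0, of n x] by linarith
    qed
    then show "\<exists>m. \<forall>w\<in>I \<times> {m..}. \<forall>x\<in>K. \<bar>?h w x * \<gamma> x\<bar> < e" by blast
  qed
  then show "\<exists>N. \<forall>t\<in>I. \<forall>n\<ge>N. p (U \<alpha> t (zs n) - U \<alpha> t z) < e" by force
qed

lemma U_generalized_riemann_integrable:
  assumes c: "0 < c" and f: "f \<in> C_weighted \<gamma>"
  shows "generalized_riemann_integrable (tau_weighted \<gamma>) (\<lambda>t. U c t f)"
proof -
  let ?g = "\<lambda>y. f y * \<gamma> y"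
  note g = weighted_C_b[OF f]
  obtain b where b: "0 \<le> b" "\<And>x. \<bar>?g x\<bar> \<le> b" using C_b_boundE[OF g] by metis
  have MB: "0 \<le> mass_bound * b" using mass_bound(1) b(1) by simp
  show ?thesis
  proof (rule generalized_riemann_integrable_weighted[OF cont pos c])
    show "U c t f \<in> C_weighted \<gamma>" if "0 \<le> t" for t by (rule U_C_weighted[OF that f])
    show "\<bar>U c t f x * \<gamma> x\<bar> \<le> mass_bound * b * exp (- c * t)" if t: "0 \<le> t" for t x
      unfolding U_weighted[OF t f] abs_mult mult.commute[of "mass_bound * b"]
      using S_bound[OF t g b(2)] by (intro mult_mono) auto
    fix K :: "'a set" and e a :: real assume K: "compact K" and e: "0 < e" and a: "0 \<le> a"
    obtain \<delta>1 where \<delta>1: "0 < \<delta>1" "\<And>s t x. s \<in> {0..a} \<Longrightarrow> t \<in> {0..a} \<Longrightarrow> \<bar>t - s\<bar> < \<delta>1 \<Longrightarrow> x \<in> K \<Longrightarrow>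
        \<bar>S t ?g x - S s ?g x\<bar> < e / 2"
      using S_uniformly_continuous_in_time[OF K g half_gt_zero[OF e] a] by meson
    have "uniformly_continuous_on {0..a} (\<lambda>t. exp (- c * t))"
      by (intro compact_uniformly_continuous continuous_intros) auto
    moreover have "0 < e / (2 * (mass_bound * b + 1))" using e MB by simp
    ultimately obtain \<delta>2 where \<delta>2: "0 < \<delta>2" "\<And>s t. s \<in> {0..a} \<Longrightarrow> t \<in> {0..a} \<Longrightarrow> \<bar>t - s\<bar> < \<delta>2 \<Longrightarrow>
        \<bar>exp (- c * t) - exp (- c * s)\<bar> < e / (2 * (mass_bound * b + 1))"
      unfolding uniformly_continuous_on_def dist_real_def by meson
    have "\<bar>U c t f x * \<gamma> x - U c s f x * \<gamma> x\<bar> < e"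
      if st: "s \<in> {0..a}" "t \<in> {0..a}" "\<bar>t - s\<bar> < min \<delta>1 \<delta>2" and x: "x \<in> K" for s t x
    proof -
      have t0: "0 \<le> t" "0 \<le> s" using st by auto
      let ?E = "\<lambda>t. exp (- c * t)"
      have sum: "U c t f x * \<gamma> x - U c s f x * \<gamma> x = ?E t * (S t ?g x - S s ?g x) + (?E t - ?E s) * S s ?g x"
        unfolding U_weighted[OF t0(1) f] U_weighted[OF t0(2) f] by (simp add: algebra_simps)
      have "\<bar>?E t * (S t ?g x - S s ?g x)\<bar> \<le> \<bar>S t ?g x - S s ?g x\<bar>"
        unfolding abs_mult using c t0 by (intro mult_left_le_one_le) auto
      moreover have "\<bar>S t ?g x - S s ?g x\<bar> < e / 2" using \<delta>1(2)[OF st(1,2)] st(3) x by simp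
      moreover have "\<bar>(?E t - ?E s) * S s ?g x\<bar> \<le> e / (2 * (mass_bound * b + 1)) * (mass_bound * b)"
        unfolding abs_mult[of "?E t - ?E s"] using \<delta>2(2)[OF st(1,2)] st(3) S_bound[OF t0(2) g b(2), of x]
        by (intro mult_mono) auto
      then have "\<bar>(?E t - ?E s) * S s ?g x\<bar> \<le> e / 2"
        by (rule order_trans) (use MB e in \<open>simp add: field_simps\<close>)
      ultimately show ?thesis unfolding sum by (rule abs_add_less_halves)
    qed
    then show "\<exists>\<delta>>0. \<forall>s\<in>{0..a}. \<forall>t\<in>{0..a}. \<bar>t - s\<bar> < \<delta> \<longrightarrow>
        (\<forall>x\<in>K. \<bar>U c t f x * \<gamma> x - U c s f x * \<gamma> x\<bar> < e)"
      using \<delta>1(1) \<delta>2(1) by (intro exI[of _ "min \<delta>1 \<delta>2"]) auto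
  qed
qed

end

theorem proposition5p3:
  fixes \<gamma> :: "'a::metric_space \<Rightarrow> real"
    and \<mu> :: "real \<Rightarrow> 'a \<Rightarrow> 'a measure"
  assumes "continuous_on UNIV \<gamma>"
    and "\<And>\<xi>. \<gamma> \<xi> > 0"
    and "\<And>t \<xi>. t \<ge> 0 \<Longrightarrow> \<mu> t \<xi> \<in> ca_plus"
    and "\<And>t \<xi>. t \<ge> 0 \<Longrightarrow> weighted_family \<gamma> \<mu> t \<xi> \<in> ca_plus"
    and "cond_A1 (weighted_family \<gamma> \<mu>)"
    and "cond_A2 (weighted_family \<gamma> \<mu>)"
    and "cond_A3 (weighted_family \<gamma> \<mu>)"
    and "cond_A4 (weighted_family \<gamma> \<mu>)"
    and "cond_A5 (weighted_family \<gamma> \<mu>)"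
  shows "C0_seq_locally_equicontinuous_semigroup (tau_weighted \<gamma>) (transition_operator \<mu>) \<and>
    (\<forall>\<alpha>>0.
      C0_seq_equicontinuous_semigroup (tau_weighted \<gamma>)
        (\<lambda>t f. exp (- \<alpha> * t) *\<^sub>R transition_operator \<mu> t f) \<and>
      (\<forall>f\<in>C_weighted \<gamma>. \<forall>\<kappa>>0.
        generalized_riemann_integrable (tau_weighted \<gamma>)
          (\<lambda>t. exp (- \<kappa> * t) *\<^sub>R exp (- \<alpha> * t) *\<^sub>R transition_operator \<mu> t f)))"
proof -
  interpret weighted_kernel_semigroup \<gamma> \<mu>
    using assms by (intro weighted_kernel_semigroup.intro kernel_semigroup.intro)
  have U0: "U 0 = Tr" by (intro ext) simp
  have local_equi: "seq_equicontinuous (tau_weighted \<gamma>) {0..R} (U 0)" if "0 < R" for R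
  proof (rule U_seq_equicontinuous)
    show "\<exists>S\<ge>0. \<forall>t\<in>{0..R}. S < t \<longrightarrow> exp (- 0 * t) < e" for e :: real
      using that by (intro exI[of _ R]) auto
  qed auto
  have equi: "seq_equicontinuous (tau_weighted \<gamma>) {0..} (U \<alpha>)" if \<alpha>: "0 < \<alpha>" for \<alpha>
  proof (rule U_seq_equicontinuous)
    fix e :: real assume e: "0 < e"
    have "exp (- \<alpha> * t) < e" if "max 0 (- ln e / \<alpha>) < t" for t
    proof -
      have "- ln e < \<alpha> * t" using that \<alpha> by (simp add: field_simps)
      then have "exp (- \<alpha> * t) < exp (ln e)" by simp
      then show ?thesis using e by simp
    qed
    then show "\<exists>R\<ge>0. \<forall>t\<in>{0..}. R < t \<longrightarrow> exp (- \<alpha> * t) < e"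
      by (intro exI[of _ "max 0 (- ln e / \<alpha>)"]) auto
  qed (use \<alpha> in auto)
  \<comment> \<open>The Laplace factor is absorbed into the rescaling.\<close>
  have combine: "exp (- \<kappa> * t) *\<^sub>R exp (- \<alpha> * t) *\<^sub>R Tr t f = U (\<kappa> + \<alpha>) t f" for \<kappa> \<alpha> t f
    by (simp add: algebra_simps flip: exp_add)
  show ?thesis
    unfolding C0_seq_locally_equicontinuous_semigroup_def C0_seq_equicontinuous_semigroup_def combine
  proof (intro conjI allI ballI impI)
    show "C0_semigroup (tau_weighted \<gamma>) Tr" using U_C0_semigroup[of 0] unfolding U0 by simp
    show "seq_equicontinuous (tau_weighted \<gamma>) {0..R} Tr" if "0 < R" for R
      using local_equi[OF that] unfolding U0 .
    fix \<alpha> :: real assume \<alpha>: "0 < \<alpha>"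
    show "C0_semigroup (tau_weighted \<gamma>) (U \<alpha>)" by (rule U_C0_semigroup[OF less_imp_le[OF \<alpha>]])
    show "seq_equicontinuous (tau_weighted \<gamma>) {0..} (U \<alpha>)" by (rule equi[OF \<alpha>])
    show "generalized_riemann_integrable (tau_weighted \<gamma>) (\<lambda>t. U (\<kappa> + \<alpha>) t f)"
      if "f \<in> C_weighted \<gamma>" "0 < \<kappa>" for f \<kappa>
      by (rule U_generalized_riemann_integrable[OF add_pos_pos[OF that(2) \<alpha>] that(1)])
  qed
qed

end
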